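(* Let $u_j=u(x,t;\omega_j)$, $j=1,\dots,J$, be an ensemble of weak solutions of the ensemble eddy viscosity model with the shear boundary conditions, each satisfying the energy inequality (as specified in the context). Suppose $\nu_{turb}(x,t)=\mu(x)\tau|u'(x,t)|_e^2$, where $\mu$ takes one constant positive value in the flow interior $\Omega\setminus\mathcal S_\beta$ and the constant positive value $\mu=\mu_\beta$ in the near wall region $\mathcal S_\beta$. If $$\mu_\beta\le0.27064\,\mathcal Re^{-1},$$ then $$\langle\varepsilon_{\text{model}}\rangle_\infty\le\left(5+32\frac{\nu}{\nu_{eff}}\right)\frac{U^3}{L}.$$
   Context: Setting. $L,U,\nu,\tau>0$, $J\ge1$ an integer, $\Omega=(0,L)^3$, with points written $(x,y,z)$ (abbreviated $x$). The large scale turnover time is $T^*=L/U$; $\tau$ is a selected time scale with $\tau\le T^*$. $\nu$ is the kinematic viscosity. Model. For $j=1,\dots,J$, $u=u(x,t;\omega_j)\in\mathbb R^3$, $p=p(x,t;\omega_j)$ satisfy (weakly, in the standard sense) $$u_t+u\cdot\nabla u-\nu\Delta u-\nabla\cdot(\nu_{turb}\nabla u)+\nabla p=0,\quad \nabla\cdot u=0\ \text{ in }\Omega,\qquad u(x,0;\omega_j)=u^0_j(x),$$ with $u_j^0\in L^2(\Omega)$ divergence free. Shear boundary conditions: $u$ is $L$-periodic in $x$ and in $y$, $u=(0,0,0)$ at $z=0$, and $u=(U,0,0)$ at $z=L$. Ensemble quantities: $\langle\psi\rangle_e=\frac1J\sum_{j=1}^J\psi(\omega_j)$; $u'(x,t;\omega_j)=u(x,t;\omega_j)-\langle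 u\rangle_e(x,t)$; $|u'|_e^2(x,t)=\frac1J\sum_{j=1}^J|u'(x,t;\omega_j)|^2$. The eddy viscosity is $\nu_{turb}(x,t)=\mu(x)\tau|u'(x,t)|_e^2$ with $\mu$ piecewise constant as in the claim. Energy inequality: for each $j$ and every divergence free $\phi(x,y,z)$ with $\phi,\nabla\phi\in L^2(\Omega)$ satisfying the shear boundary conditions, $$\frac12\frac{d}{dt}\|u\|^2+\int_\Omega[\nu+\nu_{turb}]|\nabla u|^2dx\le(u_t,\phi)+\int_\Omega[\nu+\nu_{turb}]\nabla u:\nabla\phi\,dx+(u\cdot\nabla u,\phi),$$ understood in time-integrated form over $[0,T]$, where $\|\cdot\|$ and $(\cdot,\cdot)$ are the $L^2(\Omega)$ norm and inner product. Averages and dissipation: $\langle\psi\rangle_\infty=\limsup_{T\to\infty}\frac1T\int_0^T\psi(t)\,dt$, and $$\varepsilon_{\text{model}}(t)=\left\langle\frac1{|\Omega|}\int_\Omega\nu|\nabla u(x,t;\omega_j)|^2+\nu_{turb}|\nabla u(x,t;\omega_j)|^2dx\right\rangle_e.$$ Effective viscosity: $$\nu_{eff}=\frac{\big\langle\langle\frac1{|\Omega|}\int_\Omega[\nu+\nu_{turb}]|\nabla u|^2dx\rangle_e\big\rangle_\infty}{\big\langle\langle\frac1{|\Omega|}\int_\Omega|\nabla u|^2dx\rangle_e\big\rangle_\infty},$$ where the infinite time averages appearing here are finite. $\mathcal Re=UL/\nu$, $\mathcal Re_{eff}=UL/\nu_{eff}$, $\beta=\frac18\mathcal Re_{eff}^{-1}$.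 Near wall region: $\mathcal S_\beta=\{(x,y,z):0\le x\le L,\ 0\le y\le L,\ (1-\beta)L<z<L\}$.
   Formalization: The condition β ≤ 1 is added, so that the near wall region S_β is a layer inside Ω; without it the claim fails, e.g. for the Couette flow u_j=(Uz/L,0,0) with ν>37UL, where ν_eff=ν, β>1 and the dissipation νU²/L² exceeds 37U³/L. *)

theory Defs
  imports "HOL-Analysis.Analysis"
begin

section \<open>Function spaces on the box\<close>

definition Omega :: "real \<Rightarrow> (real^3) set" where
  "Omega L = box 0 (\<chi> i. L)"

text \<open>Elements of \<open>L\<^sup>2\<close> are given by Borel representatives; \<open>L2_tendsto\<close> is convergence of a
  sequence in the \<open>L\<^sup>2\<close> norm.\<close>

definition in_L2 :: "'a::euclidean_space set \<Rightarrow> ('a \<Rightarrow> 'b::euclidean_space) \<Rightarrow> bool" where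
  "in_L2 S f \<longleftrightarrow> set_borel_measurable lborel S f \<and> set_integrable lborel S (\<lambda>x. (norm (f x))\<^sup>2)"

definition L2_tendsto ::
  "'a::euclidean_space set \<Rightarrow> (nat \<Rightarrow> 'a \<Rightarrow> 'b::euclidean_space) \<Rightarrow> ('a \<Rightarrow> 'b) \<Rightarrow> bool" where
  "L2_tendsto S f g \<longleftrightarrow>
     (\<forall>n. in_L2 S (\<lambda>x. f n x - g x)) \<and>
     (\<lambda>n. LINT x:S|lborel. (norm (f n x - g x))\<^sup>2) \<longlonglongrightarrow> 0"

primrec Ck :: "nat \<Rightarrow> ('a::real_normed_vector \<Rightarrow> 'b::real_normed_vector) \<Rightarrow> bool" where
  "Ck 0 f \<longleftrightarrow> continuous_on UNIV f"
| "Ck (Suc k) f \<longleftrightarrow>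
     (\<forall>x. f differentiable (at x)) \<and> (\<forall>h. Ck k (\<lambda>x. frechet_derivative f (at x) h))"

definition smooth :: "('a::real_normed_vector \<Rightarrow> 'b::real_normed_vector) \<Rightarrow> bool" where
  "smooth f \<longleftrightarrow> (\<forall>k. Ck k f)"

definition test_function :: "(real^3) set \<Rightarrow> (real^3 \<Rightarrow> real) \<Rightarrow> bool" where
  "test_function S \<psi> \<longleftrightarrow>
     smooth \<psi> \<and> (\<exists>K. compact K \<and> K \<subseteq> S \<and> (\<forall>x. x \<notin> K \<longrightarrow> \<psi> x = 0))"

abbreviation partial :: "3 \<Rightarrow> (real^3 \<Rightarrow> real) \<Rightarrow> real^3 \<Rightarrow> real" where
  "partial i \<psi> x \<equiv> frechet_derivative \<psi> (at x) (axis i 1)"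

text \<open>A gradient of a vector field \<open>v\<close> is a matrix field whose \<open>(k,i)\<close> entry is the \<open>i\<close>-th partial
  derivative of \<open>v\<^sub>k\<close>. Norm and inner product on \<^typ>\<open>real^3^3\<close> are the Frobenius ones.\<close>

definition weak_gradient ::
  "(real^3) set \<Rightarrow> (real^3 \<Rightarrow> real^3) \<Rightarrow> (real^3 \<Rightarrow> real^3^3) \<Rightarrow> bool" where
  "weak_gradient S v D \<longleftrightarrow>
     (\<forall>\<psi>. test_function S \<psi> \<longrightarrow>
       (\<forall>i k. (LINT x:S|lborel. v x $ k * partial i \<psi> x) = - (LINT x:S|lborel. D x $ k $ i * \<psi> x)))"

definition in_H1 :: "(real^3) set \<Rightarrow> (real^3 \<Rightarrow> real^3) \<Rightarrow> (real^3 \<Rightarrow> real^3^3) \<Rightarrow> bool" where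
  "in_H1 S v D \<longleftrightarrow> in_L2 S v \<and> in_L2 S D \<and> weak_gradient S v D"

definition div_free_L2 :: "(real^3) set \<Rightarrow> (real^3 \<Rightarrow> real^3) \<Rightarrow> bool" where
  "div_free_L2 S v \<longleftrightarrow>
     (\<forall>\<psi>. test_function S \<psi> \<longrightarrow> (LINT x:S|lborel. (\<Sum>i\<in>UNIV. v x $ i * partial i \<psi> x)) = 0)"

definition div_free_H1 :: "(real^3) set \<Rightarrow> (real^3 \<Rightarrow> real^3^3) \<Rightarrow> bool" where
  "div_free_H1 S D \<longleftrightarrow> (AE x in lborel. x \<in> S \<longrightarrow> trace (D x) = 0)"

section \<open>Traces and the shear boundary conditions\<close>

definition square :: "real \<Rightarrow> (real \<times> real) set" where
  "square L = box (0, 0) (L, L)"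

text \<open>\<open>face i c\<close> parametrises the plane on which the \<open>i\<close>-th coordinate equals \<open>c\<close>; the six faces of the
  box are the images of the square for \<open>c = 0\<close> and \<open>c = L\<close>.\<close>

definition face :: "3 \<Rightarrow> real \<Rightarrow> real \<times> real \<Rightarrow> real^3" where
  "face i c q =
     (if i = 1 then vector [c, fst q, snd q]
      else if i = 2 then vector [fst q, c, snd q]
      else vector [fst q, snd q, c])"

text \<open>The trace operator from \<open>H\<^sup>1\<close> of the box to \<open>L\<^sup>2\<close> of its boundary is the extension by continuity of
  the restriction of continuously differentiable fields. Thus \<open>g\<close> is the trace of \<open>v\<close> iff some sequence
  of such fields tends to \<open>v\<close> in \<open>H\<^sup>1\<close> while its boundary values tend to \<open>g\<close> in \<open>L\<^sup>2\<close> of the boundary.\<close>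

definition has_trace ::
  "real \<Rightarrow> (real^3 \<Rightarrow> real^3) \<Rightarrow> (real^3 \<Rightarrow> real^3^3) \<Rightarrow> (real^3 \<Rightarrow> real^3) \<Rightarrow> bool" where
  "has_trace L v D g \<longleftrightarrow>
     (\<exists>f Df. (\<forall>n x. (f n has_derivative (\<lambda>h. Df n x *v h)) (at x)) \<and>
             (\<forall>n. continuous_on UNIV (Df n)) \<and>
             L2_tendsto (Omega L) f v \<and> L2_tendsto (Omega L) Df D \<and>
             (\<forall>i. \<forall>c\<in>{0, L}. L2_tendsto (square L) (\<lambda>n q. f n (face i c q)) (\<lambda>q. g (face i c q))))"

definition shear_bc :: "real \<Rightarrow> real \<Rightarrow> (real^3 \<Rightarrow> real^3) \<Rightarrow> (real^3 \<Rightarrow> real^3^3) \<Rightarrow> bool" where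
  "shear_bc L U v D \<longleftrightarrow>
     (\<exists>g. has_trace L v D g \<and>
        (AE q in lborel. q \<in> square L \<longrightarrow>
           g (face 1 0 q) = g (face 1 L q) \<and> g (face 2 0 q) = g (face 2 L q) \<and>
           g (face 3 0 q) = 0 \<and> g (face 3 L q) = vector [U, 0, 0]))"

section \<open>Ensemble quantities\<close>

definition ens_avg :: "nat \<Rightarrow> (nat \<Rightarrow> 'a::real_vector) \<Rightarrow> 'a" where
  "ens_avg J \<psi> = (1 / real J) *\<^sub>R (\<Sum>j=1..J. \<psi> j)"

definition fluct_sq :: "nat \<Rightarrow> (nat \<Rightarrow> real \<Rightarrow> real^3 \<Rightarrow> real^3) \<Rightarrow> real \<Rightarrow> real^3 \<Rightarrow> real" where
  "fluct_sq J u t x = ens_avg J (\<lambda>j. (norm (u j t x - ens_avg J (\<lambda>k. u k t x)))\<^sup>2)"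

definition eddy_viscosity ::
  "nat \<Rightarrow> real \<Rightarrow> (real^3 \<Rightarrow> real) \<Rightarrow> (nat \<Rightarrow> real \<Rightarrow> real^3 \<Rightarrow> real^3) \<Rightarrow> real \<Rightarrow> real^3 \<Rightarrow> real" where
  "eddy_viscosity J \<tau> \<mu> u t x = \<mu> x * \<tau> * fluct_sq J u t x"

section \<open>Weak solutions and the energy inequality\<close>

text \<open>Space-time test fields for the momentum equation: smooth, solenoidal, vanishing for large times,
  periodic in the first two coordinates and zero on both walls.\<close>

definition test_field :: "real \<Rightarrow> (real \<times> (real^3) \<Rightarrow> real^3) \<Rightarrow> bool" where
  "test_field L \<psi> \<longleftrightarrow>
     smooth \<psi> \<and>
     (\<exists>T. \<forall>t\<ge>T. \<forall>x. \<psi> (t, x) = 0) \<and>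
     (\<forall>t x. \<psi> (t, x + axis 1 L) = \<psi> (t, x) \<and> \<psi> (t, x + axis 2 L) = \<psi> (t, x)) \<and>
     (\<forall>t x. x $ 3 = 0 \<or> x $ 3 = L \<longrightarrow> \<psi> (t, x) = 0) \<and>
     (\<forall>t x. trace (jacobian (\<lambda>y. \<psi> (t, y)) (at x)) = 0)"

text \<open>\<open>u\<close> is the weakly continuous representative, so that \<open>u t\<close> is meaningful for every \<open>t \<ge> 0\<close>, and
  \<open>Du t\<close> is its weak gradient for almost every \<open>t\<close>. In components \<open>Du t x *v u t x\<close> is the
  convective term. The pressure is eliminated by the solenoidal test fields.\<close>

definition weak_solution ::
  "real \<Rightarrow> real \<Rightarrow> real \<Rightarrow> (real \<Rightarrow> real^3 \<Rightarrow> real) \<Rightarrow> (real^3 \<Rightarrow> real^3) \<Rightarrow>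
   (real \<Rightarrow> real^3 \<Rightarrow> real^3) \<Rightarrow> (real \<Rightarrow> real^3 \<Rightarrow> real^3^3) \<Rightarrow> bool" where
  "weak_solution L U \<nu> \<nu>t u0 u Du \<longleftrightarrow>
     in_L2 (Omega L) u0 \<and> div_free_L2 (Omega L) u0 \<and>
     set_borel_measurable lborel ({0..} \<times> Omega L) (\<lambda>(t, x). u t x) \<and>
     set_borel_measurable lborel ({0..} \<times> Omega L) (\<lambda>(t, x). Du t x) \<and>
     (\<forall>t\<ge>0. in_L2 (Omega L) (u t)) \<and>
     (\<forall>T>0. \<exists>C. \<forall>t\<in>{0..T}. (LINT x:Omega L|lborel. (norm (u t x))\<^sup>2) \<le> C) \<and>
     (\<forall>w. in_L2 (Omega L) w \<longrightarrow> continuous_on {0..} (\<lambda>t. LINT x:Omega L|lborel. u t x \<bullet> w x)) \<and>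
     (AE x in lborel. x \<in> Omega L \<longrightarrow> u 0 x = u0 x) \<and>
     (AE t in lborel. 0 \<le> t \<longrightarrow>
        in_H1 (Omega L) (u t) (Du t) \<and> div_free_H1 (Omega L) (Du t) \<and> shear_bc L U (u t) (Du t)) \<and>
     (\<forall>T>0. set_integrable lborel ({0..T} \<times> Omega L) (\<lambda>(t, x). (norm (Du t x))\<^sup>2)) \<and>
     (\<forall>T>0. set_integrable lborel ({0..T} \<times> Omega L) (\<lambda>(t, x). \<nu>t t x * (norm (Du t x))\<^sup>2)) \<and>
     (\<forall>\<psi>. test_field L \<psi> \<longrightarrow>
        set_lebesgue_integral lborel ({0..} \<times> Omega L)
          (\<lambda>(t, x). - (u t x \<bullet> vector_derivative (\<lambda>s. \<psi> (s, x)) (at t))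
                    + (Du t x *v u t x) \<bullet> \<psi> (t, x)
                    + (\<nu> + \<nu>t t x) * (Du t x \<bullet> jacobian (\<lambda>y. \<psi> (t, y)) (at x)))
        = (LINT x:Omega L|lborel. u0 x \<bullet> \<psi> (0, x)))"

text \<open>The comparison field \<open>\<phi>\<close> does not depend on time, so the time integral of \<open>(u\<^sub>t, \<phi>)\<close> is
  \<open>(u(T) - u(0), \<phi>)\<close>. For a general \<open>\<phi>\<close> in \<open>H\<^sup>1\<close> the integrand involving \<open>\<nu>t\<close> need not be integrable;
  the inequality is required exactly when its right-hand side is well defined.\<close>

definition energy_inequality ::
  "real \<Rightarrow> real \<Rightarrow> real \<Rightarrow> (real \<Rightarrow> real^3 \<Rightarrow> real) \<Rightarrow>
   (real \<Rightarrow> real^3 \<Rightarrow> real^3) \<Rightarrow> (real \<Rightarrow> real^3 \<Rightarrow> real^3^3) \<Rightarrow> bool" where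
  "energy_inequality L U \<nu> \<nu>t u Du \<longleftrightarrow>
     (\<forall>\<phi> D\<phi>. \<forall>T>0.
        in_H1 (Omega L) \<phi> D\<phi> \<and> div_free_H1 (Omega L) D\<phi> \<and> shear_bc L U \<phi> D\<phi> \<and>
        set_integrable lborel ({0..T} \<times> Omega L) (\<lambda>(t, x). (\<nu> + \<nu>t t x) * (Du t x \<bullet> D\<phi> x)) \<and>
        set_integrable lborel ({0..T} \<times> Omega L) (\<lambda>(t, x). (Du t x *v u t x) \<bullet> \<phi> x)
        \<longrightarrow>
        1/2 * (LINT x:Omega L|lborel. (norm (u T x))\<^sup>2) - 1/2 * (LINT x:Omega L|lborel. (norm (u 0 x))\<^sup>2)
        + (LINT t:{0..T}|lborel. (LINT x:Omega L|lborel. (\<nu> + \<nu>t t x) * (norm (Du t x))\<^sup>2))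
        \<le> (LINT x:Omega L|lborel. (u T x - u 0 x) \<bullet> \<phi> x)
        + (LINT t:{0..T}|lborel. (LINT x:Omega L|lborel. (\<nu> + \<nu>t t x) * (Du t x \<bullet> D\<phi> x)))
        + (LINT t:{0..T}|lborel. (LINT x:Omega L|lborel. (Du t x *v u t x) \<bullet> \<phi> x)))"

section \<open>Long-time averages, effective viscosity and the near wall region\<close>

definition time_avg :: "(real \<Rightarrow> real) \<Rightarrow> ereal" where
  "time_avg \<psi> = Limsup at_top (\<lambda>T. ereal (1 / T * (LINT t:{0..T}|lborel. \<psi> t)))"

definition space_avg :: "real \<Rightarrow> (real^3 \<Rightarrow> real) \<Rightarrow> real" where
  "space_avg L f = 1 / measure lborel (Omega L) * (LINT x:Omega L|lborel. f x)"

definition eps_model ::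
  "real \<Rightarrow> nat \<Rightarrow> real \<Rightarrow> (real \<Rightarrow> real^3 \<Rightarrow> real) \<Rightarrow> (nat \<Rightarrow> real \<Rightarrow> real^3 \<Rightarrow> real^3^3) \<Rightarrow> real \<Rightarrow> real" where
  "eps_model L J \<nu> \<nu>t Du t =
     ens_avg J (\<lambda>j. space_avg L (\<lambda>x. \<nu> * (norm (Du j t x))\<^sup>2 + \<nu>t t x * (norm (Du j t x))\<^sup>2))"

definition mean_dissipation ::
  "real \<Rightarrow> nat \<Rightarrow> real \<Rightarrow> (real \<Rightarrow> real^3 \<Rightarrow> real) \<Rightarrow> (nat \<Rightarrow> real \<Rightarrow> real^3 \<Rightarrow> real^3^3) \<Rightarrow> ereal" where
  "mean_dissipation L J \<nu> \<nu>t Du =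
     time_avg (\<lambda>t. ens_avg J (\<lambda>j. space_avg L (\<lambda>x. (\<nu> + \<nu>t t x) * (norm (Du j t x))\<^sup>2)))"

definition mean_grad_sq :: "real \<Rightarrow> nat \<Rightarrow> (nat \<Rightarrow> real \<Rightarrow> real^3 \<Rightarrow> real^3^3) \<Rightarrow> ereal" where
  "mean_grad_sq L J Du = time_avg (\<lambda>t. ens_avg J (\<lambda>j. space_avg L (\<lambda>x. (norm (Du j t x))\<^sup>2)))"

definition nu_eff ::
  "real \<Rightarrow> nat \<Rightarrow> real \<Rightarrow> (real \<Rightarrow> real^3 \<Rightarrow> real) \<Rightarrow> (nat \<Rightarrow> real \<Rightarrow> real^3 \<Rightarrow> real^3^3) \<Rightarrow> real" where
  "nu_eff L J \<nu> \<nu>t Du =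
     real_of_ereal (mean_dissipation L J \<nu> \<nu>t Du) / real_of_ereal (mean_grad_sq L J Du)"

definition Reynolds :: "real \<Rightarrow> real \<Rightarrow> real \<Rightarrow> real" where
  "Reynolds U L \<nu> = U * L / \<nu>"

definition near_wall :: "real \<Rightarrow> real \<Rightarrow> (real^3) set" where
  "near_wall L \<beta> =
     {x. 0 \<le> x $ 1 \<and> x $ 1 \<le> L \<and> 0 \<le> x $ 2 \<and> x $ 2 \<le> L \<and> (1 - \<beta>) * L < x $ 3 \<and> x $ 3 < L}"

end

theory Submission
  imports Defs
begin

text \<open>Test the energy inequality with the shear flow \<open>\<phi> = (U r\<^sup>2, 0, 0)\<close>, where \<open>r\<close> increases linearly from 0 to 1
  across the wall layer of thickness \<open>\<beta> L\<close>; this profile, unlike the piecewise linear one, is continuously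
  differentiable. Integration by parts, incompressibility and the boundary conditions turn \<open>(u \<cdot> \<nabla>u, \<phi>)\<close> into
  \<open>- (\<phi>\<^sub>1' u\<^sub>3, u\<^sub>1 - U)\<close>, and both factors vanish at the upper wall. The weighted Poincare inequality
  \<open>\<integral> \<phi>\<^sub>1' w\<^sup>2 \<le> U \<beta> L \<integral> (\<partial>\<^sub>3 w)\<^sup>2\<close> for such \<open>w\<close> bounds it by \<open>U \<beta> L / 2 \<parallel>\<nabla>u\<parallel>\<^sup>2\<close>, and bounds the eddy viscosity part of
  \<open>\<parallel>\<nabla>\<phi>\<parallel>\<^sup>2\<close> by \<open>2 \<mu>\<^sub>\<beta> \<tau> U\<^sup>2 \<parallel>\<nabla>u\<parallel>\<^sup>2\<close>. After averaging in time, the choice of \<open>\<beta>\<close> makes the first a sixteenth of the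
  dissipation, and the bound on \<open>\<mu>\<^sub>\<beta>\<close> makes half of the second at most \<open>0.27064\<close> of it; both are absorbed.\<close>

section \<open>Integration over the box\<close>

text \<open>The number \<beta> is computed from long-time averages of the ensemble itself, so the
  comparison field exists only after \<open>\<nu>\<^sub>e\<close> is known to be positive. The
  boundary data supply this: the shear forces a positive lower bound on the mean squared gradient,
  and the viscosity carries it over to the dissipation. Weak solutions have boundary values only as
  limits, so every integration by parts is done for continuously differentiable approximants and
  passed to the limit in products of two L2-convergent factors. The eddy viscosity couples the
  realizations: the estimate for one of them contains the gradients of all, and closes only after
  averaging over the ensemble. Constants: Young's inequality leaves half of the dissipation on the
  left. After doubling, with \<open>e\<close> the mean dissipation and
  \<open>P = \<nu> / \<nu>\<^sub>e * (U ^ 3 / L)\<close>, the balance is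
  \<open>e \<le> 32/3 * P + e/8 + 2 * m * e\<close> with \<open>m = 0.27064\<close>. The conclusion
  \<open>e \<le> 32 * P\<close> requires \<open>7/8 - 2 * m \<ge> 1/3\<close>, that is
  \<open>m \<le> 13/48 = 0.27083...\<close>. In 32/3 = 8 * 4/3 the 8 comes from \<beta> and the 4/3
  from the quadratic profile.\<close>

lemma face_nth [simp]:
  "face i c q $ i = c"
  "face 1 c q $ 2 = fst q" "face 1 c q $ 3 = snd q"
  "face 2 c q $ 1 = fst q" "face 2 c q $ 3 = snd q"
  "face 3 c q $ 1 = fst q" "face 3 c q $ 2 = snd q"
  using exhaust_3[of i] by (auto simp: face_def)

lemma continuous_on_face: "continuous_on S (\<lambda>p. face i (fst p) (snd p))"
proof -
  have "continuous_on S (\<lambda>p. face i (fst p) (snd p) $ j)" for j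
    using exhaust_3[of i] exhaust_3[of j]
    by (elim disjE) (simp_all add: face_def continuous_on_fst continuous_on_snd continuous_on_id)
  then have "continuous_on S (\<lambda>p. \<chi> j. face i (fst p) (snd p) $ j)"
    by (rule continuous_on_vec_lambda)
  then show ?thesis
    by simp
qed

lemma continuous_on_face_snd: "continuous_on S (face i c)"
proof -
  have "continuous_on S (\<lambda>q. (c, q))"
    by (intro continuous_intros)
  from continuous_on_compose2[OF continuous_on_face[of UNIV i] this] show ?thesis
    by (simp add: eta_contract_eq)
qed

lemma Basis_real3: "(Basis :: (real \<times> real \<times> real) set) = {(1, 0, 0), (0, 1, 0), (0, 0, 1)}"
  by (auto simp: Basis_prod_def zero_prod_def)

lemma Basis_real2: "(Basis :: (real \<times> real) set) = {(1, 0), (0, 1)}"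
  by (auto simp: Basis_prod_def zero_prod_def)

lemma face_mem_box:
  "face i c q \<in> box l u \<longleftrightarrow>
     (c, q) \<in> box (l $ i, (if i = 1 then l $ 2 else l $ 1, if i = 3 then l $ 2 else l $ 3))
               (u $ i, (if i = 1 then u $ 2 else u $ 1, if i = 3 then u $ 2 else u $ 3))"
  using exhaust_3[of i]
  by (elim disjE; cases q) (auto simp: mem_box_cart forall_3 mem_box Basis_real3)

lemma face_mem_Omega: "face i c q \<in> Omega L \<longleftrightarrow> c \<in> {0<..<L} \<and> q \<in> square L"
  using exhaust_3[of i]
  by (elim disjE; cases q) (auto simp: Omega_def square_def mem_box_cart forall_3 mem_box Basis_real2)

text \<open>Up to the identification of triples with vectors, \<open>face i\<close> permutes
  coordinates and so preserves the volume of boxes. This gives Fubini with the \<open>i\<close>-th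
  coordinate singled out, in one form for all three directions.\<close>

lemma distr_face: "distr lborel borel (\<lambda>p. face i (fst p) (snd p)) = (lborel :: (real^3) measure)"
proof (rule lborel_eqI[symmetric])
  have meas: "(\<lambda>p. face i (fst p) (snd p)) \<in> borel_measurable lborel"
    using borel_measurable_continuous_onI[OF continuous_on_face[of UNIV i]] by simp
  fix l u :: "real^3" assume *: "\<And>b. b \<in> Basis \<Longrightarrow> l \<bullet> b \<le> u \<bullet> b"
  have le: "l $ j \<le> u $ j" for j
    using *[of "axis j 1"] by (simp add: inner_axis)
  let ?l = "(l $ i, (if i = 1 then l $ 2 else l $ 1, if i = 3 then l $ 2 else l $ 3))"
  let ?u = "(u $ i, (if i = 1 then u $ 2 else u $ 1, if i = 3 then u $ 2 else u $ 3))"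
  have "emeasure (distr lborel borel (\<lambda>p. face i (fst p) (snd p))) (box l u) = emeasure lborel (box ?l ?u)"
    using meas by (subst emeasure_distr) (auto simp: vimage_def face_mem_box)
  also have "\<dots> = (\<Prod>b\<in>Basis. (?u - ?l) \<bullet> b)"
    using le by (intro emeasure_lborel_box) (auto simp: Basis_real3)
  also have "(\<Prod>b\<in>Basis. (?u - ?l) \<bullet> b) = (\<Prod>j\<in>UNIV. u $ j - l $ j)"
  proof -
    have eq: "(\<Prod>j\<in>UNIV. f j) = f 1 * f 2 * f 3" for f :: "3 \<Rightarrow> real"
      unfolding UNIV_3 by (simp add: mult.assoc)
    consider "i = 1" | "i = 2" | "i = 3"
      using exhaust_3[of i] by blast
    then show ?thesis
      by cases (simp_all add: Basis_real3 eq)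
  qed
  also have "\<dots> = (\<Prod>b\<in>Basis. (u - l) \<bullet> b)"
    by (simp add: Basis_vec_def inner_axis UNION_singleton_eq_range prod.reindex inj_on_def axis_eq_axis)
  finally show "emeasure (distr lborel borel (\<lambda>p. face i (fst p) (snd p))) (box l u)
      = ennreal (\<Prod>b\<in>Basis. (u - l) \<bullet> b)" .
qed simp

abbreviation box_measure :: "real \<Rightarrow> (real^3) measure" where
  "box_measure L \<equiv> restrict_space lborel (Omega L)"

abbreviation square_measure :: "real \<Rightarrow> (real \<times> real) measure" where
  "square_measure L \<equiv> restrict_space lborel (square L)"

lemma Omega_borel [measurable, simp]: "Omega L \<in> sets borel"
  by (simp add: Omega_def)

lemma square_borel [measurable, simp]: "square L \<in> sets borel"
  by (simp add: square_def)

lemma mem_Omega: "x \<in> Omega L \<longleftrightarrow> (\<forall>i. 0 < x $ i \<and> x $ i < L)"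
  by (simp add: Omega_def mem_box_cart)

lemma integral_restrict_lborel:
  fixes f :: "'a::euclidean_space \<Rightarrow> 'b::euclidean_space"
  assumes "S \<in> sets borel"
  shows "(LINT x:S|lborel. f x) = integral\<^sup>L (restrict_space lborel S) f"
  using assms integral_restrict_space[of S lborel f] by (simp add: set_lebesgue_integral_def)

lemma set_integrable_restrict_lborel:
  fixes f :: "'a::euclidean_space \<Rightarrow> 'b::euclidean_space"
  assumes "S \<in> sets borel"
  shows "set_integrable lborel S f \<longleftrightarrow> integrable (restrict_space lborel S) f"
  using assms integrable_restrict_space[of S lborel f] by (simp add: set_integrable_def)

lemma set_borel_measurable_restrict_lborel:
  fixes f :: "'a::euclidean_space \<Rightarrow> 'b::euclidean_space"
  assumes "S \<in> sets borel"
  shows "set_borel_measurable lborel S f \<longleftrightarrow> f \<in> borel_measurable (restrict_space lborel S)"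
  using assms borel_measurable_restrict_space_iff[of S lborel f] by (simp add: set_borel_measurable_def)

lemma integrable_continuous_bounded_set:
  fixes f :: "'a::euclidean_space \<Rightarrow> 'b::euclidean_space"
  assumes "continuous_on UNIV f" "S \<in> sets borel" "bounded S"
  shows "integrable (restrict_space lborel S) f"
proof -
  obtain a where a: "S \<subseteq> cbox (- a) a"
    using bounded_subset_cbox_symmetric[OF assms(3)] by blast
  have "set_integrable lborel (cbox (-a) a) f"
    unfolding set_integrable_def
    by (intro borel_integrable_compact continuous_on_subset[OF assms(1)]) auto
  then have "set_integrable lborel S f"
    using set_integrable_subset[OF _ _ a, of lborel f] assms(2) by simp
  then show ?thesis
    using assms(2) by (simp add: set_integrable_restrict_lborel)
qed

lemma bounded_Omega: "bounded (Omega L)" and bounded_square: "bounded (square L)"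
  by (simp_all add: Omega_def square_def)

lemma continuous_on_imp_bounded_on:
  fixes f :: "'a::euclidean_space \<Rightarrow> real"
  assumes "continuous_on UNIV f" "bounded S"
  obtains C where "C > 0" "\<And>x. x \<in> S \<Longrightarrow> \<bar>f x\<bar> \<le> C"
proof -
  obtain a where a: "S \<subseteq> cbox (- a) a"
    using bounded_subset_cbox_symmetric[OF assms(2)] by blast
  have "bounded (f ` cbox (-a) a)"
    by (intro compact_imp_bounded compact_continuous_image continuous_on_subset[OF assms(1)]) auto
  then obtain C where "\<forall>x\<in>f ` cbox (-a) a. norm x \<le> C"
    by (auto simp: bounded_iff)
  with a have "\<And>x. x \<in> S \<Longrightarrow> \<bar>f x\<bar> \<le> max C 1"
    by fastforce
  then show ?thesis
    by (intro that[of "max C 1"]) auto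
qed

text \<open>The fundamental theorem of calculus on each line in direction \<open>i\<close>, followed
  by Fubini through \<open>distr_face\<close>. All boundary integrals of the development come from
  here.\<close>

lemma integral_partial_box:
  fixes f :: "real^3 \<Rightarrow> real" and G :: "real^3 \<Rightarrow> real^3"
  assumes der: "\<And>x. (f has_derivative (\<lambda>h. G x \<bullet> h)) (at x)"
    and cont: "continuous_on UNIV G" and L: "L > 0"
  shows "(\<integral>x. G x $ i \<partial>box_measure L) = (\<integral>q. f (face i L q) - f (face i 0 q) \<partial>square_measure L)"
proof -
  have contG: "continuous_on UNIV (\<lambda>x. G x $ i)"
    by (intro continuous_intros cont)
  have face_meas [measurable]: "(\<lambda>p. face i (fst p) (snd p)) \<in> borel_measurable borel"
    by (intro borel_measurable_continuous_onI continuous_on_face)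
  have G_meas [measurable]: "(\<lambda>x. G x $ i) \<in> borel_measurable borel"
    by (intro borel_measurable_continuous_onI contG)
  define k where "k p = indicator (Omega L) (face i (fst p) (snd p)) *\<^sub>R G (face i (fst p) (snd p)) $ i"
    for p :: "real \<times> real \<times> real"
  have "integrable (distr lborel borel (\<lambda>p. face i (fst p) (snd p))) (\<lambda>x. indicator (Omega L) x *\<^sub>R G x $ i)"
    using integrable_continuous_bounded_set[OF contG Omega_borel bounded_Omega[of L]]
    by (simp add: distr_face flip: set_integrable_restrict_lborel) (simp add: set_integrable_def)
  then have "integrable lborel k"
    unfolding k_def by (subst (asm) integrable_distr_eq) auto
  then have k_int: "integrable (lborel \<Otimes>\<^sub>M lborel) (\<lambda>(c, q). k (c, q))"
    by (simp add: lborel_prod)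
  have inner: "(\<integral>c. k (c, q) \<partial>lborel) = indicator (square L) q *\<^sub>R (f (face i L q) - f (face i 0 q))" for q
  proof -
    have d: "((\<lambda>c. f (face i c q)) has_vector_derivative G (face i c q) $ i) (at c within A)" for c A
    proof -
      consider "i = 1" | "i = 2" | "i = 3"
        using exhaust_3[of i] by blast
      then have line: "(\<lambda>c. face i c q) = (\<lambda>c. face i 0 q + c *\<^sub>R axis i 1)"
        by cases (auto simp: fun_eq_iff vec_eq_iff forall_3 axis_def)
      have "((\<lambda>c. face i c q) has_derivative (\<lambda>h. h *\<^sub>R axis i 1)) (at c within A)"
        by (subst line) (auto intro!: derivative_eq_intros)
      from has_derivative_compose[OF this has_derivative_at_withinI[OF der]] show ?thesis
        by (simp add: has_vector_derivative_def inner_axis mult.commute)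
    qed
    have "continuous_on UNIV (\<lambda>c. (c, q))"
      by (intro continuous_intros)
    from continuous_on_compose2[OF continuous_on_face[of UNIV i] this]
    have face_cont: "continuous_on UNIV (\<lambda>c. face i c q)" by simp
    from continuous_on_compose2[OF contG this]
    have G_cont: "continuous_on UNIV (\<lambda>c. G (face i c q) $ i)" by simp
    have cf: "continuous_on {0..L} (\<lambda>c. G (face i c q) $ i)"
      by (rule continuous_on_subset[OF G_cont]) simp
    have k_eq: "k (c, q) = indicator (square L) q * (indicator {0<..<L} c * G (face i c q) $ i)" for c
      by (auto simp: k_def indicator_def face_mem_Omega)
    have "(\<integral>c. k (c, q) \<partial>lborel)
        = (\<integral>c. indicator (square L) q *\<^sub>R (indicator {0..L} c *\<^sub>R G (face i c q) $ i) \<partial>lborel)"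
    proof (rule integral_cong_AE)
      have [measurable]: "(\<lambda>c. G (face i c q) $ i) \<in> borel_measurable borel"
        by (intro borel_measurable_continuous_onI G_cont)
      show "(\<lambda>c. k (c, q)) \<in> borel_measurable lborel"
        unfolding k_eq by measurable
      show "(\<lambda>c. indicator (square L) q *\<^sub>R (indicator {0..L} c *\<^sub>R G (face i c q) $ i)) \<in> borel_measurable lborel"
        by simp
      \<comment> \<open>The box is open while the fundamental theorem is applied on the closed
        interval; the two integrands differ only at the end points.\<close>
      have "AE c in lborel. c \<noteq> 0 \<and> c \<noteq> L"
        using AE_lborel_singleton[of "0::real"] AE_lborel_singleton[of L] by simp
      then show "AE c in lborel. k (c, q) = indicator (square L) q *\<^sub>R (indicator {0..L} c *\<^sub>R G (face i c q) $ i)"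
        by eventually_elim (auto simp: k_eq indicator_def)
    qed
    also have "\<dots> = indicator (square L) q *\<^sub>R (f (face i L q) - f (face i 0 q))"
      using integral_FTC_atLeastAtMost[of 0 L, OF _ d cf] L by simp
    finally show ?thesis .
  qed
  have "(\<integral>x. G x $ i \<partial>box_measure L)
      = (\<integral>x. indicator (Omega L) x *\<^sub>R G x $ i \<partial>distr lborel borel (\<lambda>p. face i (fst p) (snd p)))"
    by (simp add: distr_face flip: integral_restrict_lborel) (simp add: set_lebesgue_integral_def)
  also have "\<dots> = integral\<^sup>L lborel k"
    unfolding k_def by (subst integral_distr) auto
  also have "\<dots> = (\<integral>q. (\<integral>c. k (c, q) \<partial>lborel) \<partial>lborel)"
    using lborel_pair.integral_snd[OF k_int] by (simp add: lborel_prod)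
  also have "\<dots> = (\<integral>q. f (face i L q) - f (face i 0 q) \<partial>square_measure L)"
    by (simp add: inner flip: integral_restrict_lborel) (simp add: set_lebesgue_integral_def)
  finally show ?thesis .
qed

section \<open>Limits in L2 and integration by parts\<close>

text \<open>\<open>L2_tendsto\<close> speaks only of differences. Here square integrability of the
  terms and of the limit is included, because products of two such functions have to be integrable.
  The measure is arbitrary, so that box and faces are treated alike.\<close>

definition L2_lim :: "'a measure \<Rightarrow> (nat \<Rightarrow> 'a \<Rightarrow> real) \<Rightarrow> ('a \<Rightarrow> real) \<Rightarrow> bool" where
  "L2_lim M a a0 \<longleftrightarrow>
     (\<forall>n. a n \<in> borel_measurable M \<and> integrable M (\<lambda>x. (a n x)\<^sup>2)) \<and>
     a0 \<in> borel_measurable M \<and> integrable M (\<lambda>x. (a0 x)\<^sup>2) \<and>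
     (\<lambda>n. \<integral>x. (a n x - a0 x)\<^sup>2 \<partial>M) \<longlonglongrightarrow> 0"

lemma abs_mult_le_half_squares: "\<bar>a * b\<bar> \<le> ((a::real)\<^sup>2 + b\<^sup>2) / 2"
  using sum_squares_bound[of "\<bar>a\<bar>" "\<bar>b\<bar>"] by (simp add: abs_mult)

lemma integrable_mult_square:
  fixes a b h :: "'a \<Rightarrow> real"
  assumes [measurable]: "a \<in> borel_measurable M" "b \<in> borel_measurable M" "h \<in> borel_measurable M"
    and int: "integrable M (\<lambda>x. (a x)\<^sup>2)" "integrable M (\<lambda>x. (b x)\<^sup>2)"
    and h: "\<And>x. x \<in> space M \<Longrightarrow> \<bar>h x\<bar> \<le> C"
  shows "integrable M (\<lambda>x. h x * a x * b x)"
proof (rule Bochner_Integration.integrable_bound)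
  show "integrable M (\<lambda>x. C * (((a x)\<^sup>2 + (b x)\<^sup>2) / 2))"
    using int by simp
  have "norm (h x * a x * b x) \<le> norm (C * (((a x)\<^sup>2 + (b x)\<^sup>2) / 2))" if "x \<in> space M" for x
  proof -
    have "\<bar>h x\<bar> * \<bar>a x * b x\<bar> \<le> C * (((a x)\<^sup>2 + (b x)\<^sup>2) / 2)"
      using h[OF that] by (intro mult_mono abs_mult_le_half_squares) auto
    then have "\<bar>h x * a x * b x\<bar> \<le> C * (((a x)\<^sup>2 + (b x)\<^sup>2) / 2)"
      by (simp only: abs_mult mult.assoc)
    then show ?thesis
      unfolding real_norm_def by (rule order_trans) (rule abs_ge_self)
  qed
  then show "AE x in M. norm (h x * a x * b x) \<le> norm (C * (((a x)\<^sup>2 + (b x)\<^sup>2) / 2))"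
    by simp
qed measurable

lemma integrable_square_diff:
  fixes a b :: "'a \<Rightarrow> real"
  assumes [measurable]: "a \<in> borel_measurable M" "b \<in> borel_measurable M"
    and int: "integrable M (\<lambda>x. (a x)\<^sup>2)" "integrable M (\<lambda>x. (b x)\<^sup>2)"
  shows "integrable M (\<lambda>x. (a x - b x)\<^sup>2)"
proof (rule Bochner_Integration.integrable_bound)
  show "integrable M (\<lambda>x. 2 * (a x)\<^sup>2 + 2 * (b x)\<^sup>2)"
    using int by simp
  have "(a x - b x)\<^sup>2 \<le> 2 * (a x)\<^sup>2 + 2 * (b x)\<^sup>2" for x
    using zero_le_power2[of "a x + b x"] by (simp add: power2_eq_square algebra_simps)
  then show "AE x in M. norm ((a x - b x)\<^sup>2) \<le> norm (2 * (a x)\<^sup>2 + 2 * (b x)\<^sup>2)"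
    by simp
qed measurable

text \<open>The product difference splits into one term quadratic in the errors and two mixed terms.
  Young's inequality with a free parameter \<open>d\<close> puts \<open>1 / d\<close> on the squared
  errors, which vanish as \<open>n\<close> grows, and \<open>d\<close> on the fixed squares of the
  limits.\<close>

lemma L2_lim_mult:
  assumes a: "L2_lim M a a0" and b: "L2_lim M b b0"
    and [measurable]: "h \<in> borel_measurable M" and h: "\<And>x. x \<in> space M \<Longrightarrow> \<bar>h x\<bar> \<le> C"
  shows "(\<lambda>n. \<integral>x. h x * a n x * b n x \<partial>M) \<longlonglongrightarrow> (\<integral>x. h x * a0 x * b0 x \<partial>M)"
    and "integrable M (\<lambda>x. h x * a n x * b n x)"
    and "integrable M (\<lambda>x. h x * a0 x * b0 x)"
proof -
  have [measurable]: "\<And>n. a n \<in> borel_measurable M" "\<And>n. b n \<in> borel_measurable M"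
      "a0 \<in> borel_measurable M" "b0 \<in> borel_measurable M"
    using a b by (auto simp: L2_lim_def)
  have sq: "integrable M (\<lambda>x. (a n x)\<^sup>2)" "integrable M (\<lambda>x. (b n x)\<^sup>2)"
      "integrable M (\<lambda>x. (a0 x)\<^sup>2)" "integrable M (\<lambda>x. (b0 x)\<^sup>2)" for n
    using a b by (auto simp: L2_lim_def)
  have dsq: "integrable M (\<lambda>x. (a n x - a0 x)\<^sup>2)" "integrable M (\<lambda>x. (b n x - b0 x)\<^sup>2)" for n
    by (intro integrable_square_diff sq; measurable)+
  have i1: "integrable M (\<lambda>x. h x * a n x * b n x)" for n
    by (rule integrable_mult_square[OF _ _ _ sq(1) sq(2) h]) auto
  then show "integrable M (\<lambda>x. h x * a n x * b n x)" .
  show i0: "integrable M (\<lambda>x. h x * a0 x * b0 x)"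
    by (rule integrable_mult_square[OF _ _ _ sq(3) sq(4) h]) auto
  define A B where "A = (\<lambda>n. \<integral>x. (a n x - a0 x)\<^sup>2 \<partial>M)" and "B = (\<lambda>n. \<integral>x. (b n x - b0 x)\<^sup>2 \<partial>M)"
  define K where "K = (\<integral>x. (a0 x)\<^sup>2 \<partial>M) + (\<integral>x. (b0 x)\<^sup>2 \<partial>M)"
  have A: "A \<longlonglongrightarrow> 0" and B: "B \<longlonglongrightarrow> 0"
    using a b by (auto simp: L2_lim_def A_def B_def)
  have K: "K \<ge> 0"
    by (simp add: K_def)
  define D where "D = max C 1"
  have D: "D > 0" and hD: "\<And>x. x \<in> space M \<Longrightarrow> \<bar>h x\<bar> \<le> D"
    using h by (force simp: D_def)+
  have est: "\<bar>(\<integral>x. h x * a n x * b n x \<partial>M) - (\<integral>x. h x * a0 x * b0 x \<partial>M)\<bar>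
      \<le> D * ((1 + 1 / d) * (A n + B n) + d * K)" if d: "d > 0" for n d
  proof -
    let ?r = "\<lambda>x. D * ((1 + 1 / d) * ((a n x - a0 x)\<^sup>2 + (b n x - b0 x)\<^sup>2) + d * ((a0 x)\<^sup>2 + (b0 x)\<^sup>2))"
    have pt: "\<bar>h x * a n x * b n x - h x * a0 x * b0 x\<bar> \<le> ?r x" if "x \<in> space M" for x
    proof -
      have young: "\<bar>p * q\<bar> \<le> (1 / d) * p\<^sup>2 + d * q\<^sup>2" for p q :: real
      proof -
        have "0 \<le> (\<bar>p\<bar> - d * \<bar>q\<bar>)\<^sup>2 / d + (p\<^sup>2 / d + d * q\<^sup>2)"
          using d by simp
        also have "\<dots> = 2 * ((1 / d) * p\<^sup>2 + d * q\<^sup>2 - \<bar>p * q\<bar>)"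
          using d by (simp add: power2_eq_square field_simps abs_mult)
        finally have "\<bar>p * q\<bar> \<le> (1 / d) * p\<^sup>2 + d * q\<^sup>2"
          by (simp only: zero_le_mult_iff) simp
        then show ?thesis .
      qed
      have "a n x * b n x - a0 x * b0 x
          = (a n x - a0 x) * (b n x - b0 x) + (a n x - a0 x) * b0 x + (b n x - b0 x) * a0 x"
        by (simp add: algebra_simps)
      then have "\<bar>a n x * b n x - a0 x * b0 x\<bar> \<le> \<bar>(a n x - a0 x) * (b n x - b0 x)\<bar>
           + \<bar>(a n x - a0 x) * b0 x\<bar> + \<bar>(b n x - b0 x) * a0 x\<bar>"
        by linarith
      also have "\<dots> \<le> ((a n x - a0 x)\<^sup>2 + (b n x - b0 x)\<^sup>2)
           + ((1 / d) * (a n x - a0 x)\<^sup>2 + d * (b0 x)\<^sup>2) + ((1 / d) * (b n x - b0 x)\<^sup>2 + d * (a0 x)\<^sup>2)"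
        using young abs_mult_le_half_squares[of "a n x - a0 x" "b n x - b0 x"]
        by (intro add_mono) (auto intro: order_trans)
      also have "\<dots> = (1 + 1 / d) * ((a n x - a0 x)\<^sup>2 + (b n x - b0 x)\<^sup>2) + d * ((a0 x)\<^sup>2 + (b0 x)\<^sup>2)"
        by (simp add: distrib_left distrib_right)
      finally have "\<bar>h x\<bar> * \<bar>a n x * b n x - a0 x * b0 x\<bar> \<le> ?r x"
        using hD[OF that] D by (intro mult_mono) auto
      then show ?thesis
        by (simp add: abs_mult[symmetric] right_diff_distrib mult.assoc)
    qed
    have r: "integrable M ?r"
      using dsq sq by simp
    have "\<bar>(\<integral>x. h x * a n x * b n x \<partial>M) - (\<integral>x. h x * a0 x * b0 x \<partial>M)\<bar>
        = \<bar>\<integral>x. h x * a n x * b n x - h x * a0 x * b0 x \<partial>M\<bar>"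
      using i1 i0 by simp
    also have "\<dots> \<le> (\<integral>x. ?r x \<partial>M)"
      using pt by (intro integral_abs_bound[THEN order_trans] integral_mono r integrable_abs Bochner_Integration.integrable_diff i1 i0)
    also have "\<dots> = D * ((1 + 1 / d) * (A n + B n) + d * K)"
      using dsq sq by (simp add: A_def B_def K_def)
    finally show ?thesis .
  qed
  show "(\<lambda>n. \<integral>x. h x * a n x * b n x \<partial>M) \<longlonglongrightarrow> (\<integral>x. h x * a0 x * b0 x \<partial>M)"
  proof (rule LIMSEQ_I)
    fix e :: real assume e: "e > 0"
    \<comment> \<open>Chosen so that the part of \<open>est\<close> that does not decay,
      \<open>D * d * K\<close>, is at most \<open>e / 2\<close>; the 1 in \<open>K + 1\<close>
      covers \<open>K = 0\<close>.\<close>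
    define d where "d = e / (2 * D * (K + 1))"
    have d: "d > 0"
      using e D K by (simp add: d_def)
    have "D * (d * K) = e / 2 * (K / (K + 1))"
      using D K by (simp add: d_def)
    also have "\<dots> \<le> e / 2 * 1"
      using e K by (intro mult_left_mono) auto
    finally have dK: "D * (d * K) < e"
      using e by simp
    have "(\<lambda>n. D * ((1 + 1 / d) * (A n + B n) + d * K)) \<longlonglongrightarrow> D * ((1 + 1 / d) * (0 + 0) + d * K)"
      by (intro tendsto_intros A B)
    moreover have "D * ((1 + 1 / d) * (0 + 0) + d * K) < e"
      using dK by simp
    ultimately have "\<forall>\<^sub>F n in sequentially. D * ((1 + 1 / d) * (A n + B n) + d * K) < e"
      by (rule order_tendstoD)
    then have "\<forall>\<^sub>F n in sequentially. \<bar>(\<integral>x. h x * a n x * b n x \<partial>M) - (\<integral>x. h x * a0 x * b0 x \<partial>M)\<bar> < e"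
      using est[OF d] by (auto elim!: eventually_mono intro: order.strict_trans1)
    then show "\<exists>no. \<forall>n\<ge>no. norm ((\<integral>x. h x * a n x * b n x \<partial>M) - (\<integral>x. h x * a0 x * b0 x \<partial>M)) < e"
      by (simp add: eventually_sequentially)
  qed
qed

lemma L2_lim_const:
  assumes "a \<in> borel_measurable M" "integrable M (\<lambda>x. (a x)\<^sup>2)"
  shows "L2_lim M (\<lambda>n. a) a"
  using assms by (simp add: L2_lim_def)

text \<open>Composition with a 1-Lipschitz scalar function does not increase the error. In the
  applications \<pi> picks an entry, possibly shifted by a constant.\<close>

lemma L2_tendsto_imp_L2_lim:
  fixes f :: "nat \<Rightarrow> 'a::euclidean_space \<Rightarrow> 'b::euclidean_space" and \<pi> :: "'b \<Rightarrow> real"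
  assumes conv: "L2_tendsto S f v" and cont: "\<And>n. continuous_on UNIV (f n)"
    and S: "S \<in> sets borel" "bounded S"
    and lip: "\<And>y z. \<bar>\<pi> y - \<pi> z\<bar> \<le> norm (y - z)"
  shows "L2_lim (restrict_space lborel S) (\<lambda>n x. \<pi> (f n x)) (\<lambda>x. \<pi> (v x))"
proof -
  let ?M = "restrict_space lborel S"
  have "continuous_on UNIV \<pi>"
    by (rule lipschitz_on_continuous_on[of 1]) (auto intro!: lipschitz_onI simp: dist_norm lip)
  then have cont': "continuous_on UNIV (\<lambda>x. \<pi> (f n x))" for n
    using continuous_on_compose2[OF _ cont[of n]] by blast
  then have f: "(\<lambda>x. \<pi> (f n x)) \<in> borel_measurable ?M" for n
    by (intro measurable_restrict_space1) (simp add: borel_measurable_continuous_onI)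
  have f2: "integrable ?M (\<lambda>x. (\<pi> (f n x))\<^sup>2)" for n
    by (intro integrable_continuous_bounded_set S continuous_intros cont')
  have d: "(\<lambda>x. f n x - v x) \<in> borel_measurable ?M" "integrable ?M (\<lambda>x. (norm (f n x - v x))\<^sup>2)" for n
    using conv by (auto simp: L2_tendsto_def in_L2_def S set_borel_measurable_restrict_lborel set_integrable_restrict_lborel)
  \<comment> \<open>The hypothesis gives measurability and square integrability of
    \<open>f n - v\<close> only; both are recovered for the limit by subtracting this difference
    from the continuous function \<open>f 0\<close>.\<close>
  have "f 0 \<in> borel_measurable ?M"
    using cont[of 0] by (intro measurable_restrict_space1) (simp add: borel_measurable_continuous_onI)
  from borel_measurable_diff[OF this d(1)[of 0]] have "v \<in> borel_measurable ?M"
    by simp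
  moreover have "\<pi> \<in> borel_measurable borel"
    by (rule borel_measurable_continuous_onI) fact
  ultimately have v: "(\<lambda>x. \<pi> (v x)) \<in> borel_measurable ?M"
    by (rule measurable_compose)
  have le: "(\<pi> (f n x) - \<pi> (v x))\<^sup>2 \<le> (norm (f n x - v x))\<^sup>2" for n x
    using lip[of "f n x" "v x"] by (simp add: abs_le_square_iff[symmetric])
  note f [measurable] v [measurable]
  have fv2: "integrable ?M (\<lambda>x. (\<pi> (f n x) - \<pi> (v x))\<^sup>2)" for n
    by (rule Bochner_Integration.integrable_bound[OF d(2)[of n]]) (use le in auto)
  have v2: "integrable ?M (\<lambda>x. (\<pi> (v x))\<^sup>2)"
    using integrable_square_diff[OF f[of 0] _ f2[of 0] fv2[of 0]] by simp
  have "(\<lambda>n. \<integral>x. (norm (f n x - v x))\<^sup>2 \<partial>?M) \<longlonglongrightarrow> 0"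
    using conv S by (simp add: L2_tendsto_def integral_restrict_lborel)
  then have "(\<lambda>n. \<integral>x. (\<pi> (f n x) - \<pi> (v x))\<^sup>2 \<partial>?M) \<longlonglongrightarrow> 0"
    by (rule tendsto_sandwich[OF _ _ tendsto_const, rotated 2])
       (auto intro!: always_eventually integral_mono fv2 d le)
  with f f2 v v2 show ?thesis
    by (simp add: L2_lim_def)
qed

text \<open>The one-component counterpart of \<open>has_trace\<close>: \<open>a\<close> has gradient
  \<open>A\<close> and boundary values \<alpha>. Working with scalars allows each component to be
  shifted by its own wall velocity.\<close>

definition scalar_trace :: "real \<Rightarrow> (real^3 \<Rightarrow> real) \<Rightarrow> (real^3 \<Rightarrow> real^3) \<Rightarrow> (real^3 \<Rightarrow> real) \<Rightarrow> bool" where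
  "scalar_trace L a A \<alpha> \<longleftrightarrow>
     (\<exists>f G. (\<forall>n x. (f n has_derivative (\<lambda>h. G n x \<bullet> h)) (at x)) \<and>
            (\<forall>n. continuous_on UNIV (G n)) \<and>
            L2_lim (box_measure L) f a \<and>
            (\<forall>i. L2_lim (box_measure L) (\<lambda>n x. G n x $ i) (\<lambda>x. A x $ i)) \<and>
            (\<forall>i. \<forall>c\<in>{0, L}. L2_lim (square_measure L) (\<lambda>n q. f n (face i c q)) (\<lambda>q. \<alpha> (face i c q))))"

lemma scalar_trace_component:
  assumes "has_trace L v D g"
  shows "scalar_trace L (\<lambda>x. v x $ k - c) (\<lambda>x. D x $ k) (\<lambda>x. g x $ k - c)"
proof -
  from assms obtain f Df where
    der: "\<And>n x. (f n has_derivative (\<lambda>h. Df n x *v h)) (at x)" and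
    cont: "\<And>n. continuous_on UNIV (Df n)" and
    f: "L2_tendsto (Omega L) f v" and Df: "L2_tendsto (Omega L) Df D" and
    tr: "\<And>i c. c \<in> {0, L} \<Longrightarrow> L2_tendsto (square L) (\<lambda>n q. f n (face i c q)) (\<lambda>q. g (face i c q))"
    unfolding has_trace_def by blast
  have contf: "continuous_on UNIV (f n)" for n
    using der by (auto intro!: has_derivative_continuous_on)
  have contface: "continuous_on UNIV (\<lambda>q. f n (face i d q))" for n i d
    by (rule continuous_on_compose2[OF contf continuous_on_face_snd]) simp
  have lip: "\<bar>(y $ k - c) - (z $ k - c)\<bar> \<le> norm (y - z)" for y z :: "real^3"
    using component_le_norm_cart[of "y - z" k] by simp
  have lip2: "\<bar>y $ k $ i - z $ k $ i\<bar> \<le> norm (y - z)" for y z :: "real^3^3" and i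
    using order_trans[OF component_le_norm_cart[of "(y - z) $ k" i]] Finite_Cartesian_Product.norm_nth_le[of "y - z" k] by simp
  show ?thesis
    unfolding scalar_trace_def
  proof (intro exI[of _ "\<lambda>n x. f n x $ k - c"] exI[of _ "\<lambda>n x. Df n x $ k"] conjI allI ballI)
    fix n x
    show "((\<lambda>x. f n x $ k - c) has_derivative (\<lambda>h. Df n x $ k \<bullet> h)) (at x)"
      using bounded_linear.has_derivative[OF bounded_linear_vec_nth[of k] der[of n x]]
      by (auto intro!: derivative_eq_intros simp: matrix_vector_mul_component)
  next
    fix n show "continuous_on UNIV (\<lambda>x. Df n x $ k)"
      by (intro continuous_intros cont)
  next
    show "L2_lim (box_measure L) (\<lambda>n x. f n x $ k - c) (\<lambda>x. v x $ k - c)"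
      by (rule L2_tendsto_imp_L2_lim[OF f contf Omega_borel bounded_Omega lip])
  next
    fix i show "L2_lim (box_measure L) (\<lambda>n x. Df n x $ k $ i) (\<lambda>x. D x $ k $ i)"
      by (rule L2_tendsto_imp_L2_lim[OF Df cont Omega_borel bounded_Omega lip2])
  next
    fix i d assume "d \<in> {0, L}"
    then show "L2_lim (square_measure L) (\<lambda>n q. f n (face i d q) $ k - c) (\<lambda>q. g (face i d q) $ k - c)"
      by (intro L2_tendsto_imp_L2_lim[OF tr contface square_borel bounded_square lip])
  qed
qed

text \<open>Taken as second factor in the integration by parts below, the constant 1 yields the
  divergence theorem for a single field.\<close>

lemma scalar_trace_const: "scalar_trace L (\<lambda>_. c) (\<lambda>_. 0) (\<lambda>_. c)"
proof -
  have b: "integrable (box_measure L) (\<lambda>_. r :: real)" "integrable (square_measure L) (\<lambda>_. r :: real)" for r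
    by (intro integrable_continuous_bounded_set bounded_Omega bounded_square; simp)+
  show ?thesis
    unfolding scalar_trace_def
    by (intro exI[of _ "\<lambda>n x. c"] exI[of _ "\<lambda>n x. 0"]) (auto intro!: L2_lim_const b derivative_eq_intros)
qed

lemma scalar_trace_L2:
  assumes "scalar_trace L a A \<alpha>"
  shows "a \<in> borel_measurable (box_measure L)" "integrable (box_measure L) (\<lambda>x. (a x)\<^sup>2)"
    "(\<lambda>x. A x $ i) \<in> borel_measurable (box_measure L)" "integrable (box_measure L) (\<lambda>x. (A x $ i)\<^sup>2)"
  using assms by (auto simp: scalar_trace_def L2_lim_def)

text \<open>The product rule for \<open>h * f n * g n\<close>, with C1 approximants of the two rough
  factors, integrates to a boundary term by \<open>integral_partial_box\<close>. Each resulting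
  integral is a bounded weight times two L2-convergent functions, so \<open>L2_lim_mult\<close>
  applies to it on the box and on both faces.\<close>

lemma
  assumes a: "scalar_trace L a A \<alpha>" and b: "scalar_trace L b B \<beta>"
    and h: "\<And>x. (h has_derivative (\<lambda>k. H x \<bullet> k)) (at x)" and H: "continuous_on UNIV H" and L: "L > 0"
  shows integration_by_parts_box:
     "(\<integral>x. H x $ i * a x * b x + h x * A x $ i * b x + h x * a x * B x $ i \<partial>box_measure L)
      = (\<integral>q. h (face i L q) * \<alpha> (face i L q) * \<beta> (face i L q)
              - h (face i 0 q) * \<alpha> (face i 0 q) * \<beta> (face i 0 q) \<partial>square_measure L)"
    and integrable_by_parts_box:
     "integrable (box_measure L) (\<lambda>x. H x $ i * a x * b x)"
     "integrable (box_measure L) (\<lambda>x. h x * A x $ i * b x)"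
     "integrable (box_measure L) (\<lambda>x. h x * a x * B x $ i)"
proof -
  from a obtain f F where
    f_der: "\<And>n x. (f n has_derivative (\<lambda>h. F n x \<bullet> h)) (at x)" and
    F_cont: "\<And>n. continuous_on UNIV (F n)" and
    f: "L2_lim (box_measure L) f a" and F: "\<And>i. L2_lim (box_measure L) (\<lambda>n x. F n x $ i) (\<lambda>x. A x $ i)" and
    f_tr: "\<And>i c. c \<in> {0, L} \<Longrightarrow> L2_lim (square_measure L) (\<lambda>n q. f n (face i c q)) (\<lambda>q. \<alpha> (face i c q))"
    unfolding scalar_trace_def by blast
  from b obtain g G where
    g_der: "\<And>n x. (g n has_derivative (\<lambda>h. G n x \<bullet> h)) (at x)" and
    G_cont: "\<And>n. continuous_on UNIV (G n)" and
    g: "L2_lim (box_measure L) g b" and G: "\<And>i. L2_lim (box_measure L) (\<lambda>n x. G n x $ i) (\<lambda>x. B x $ i)" and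
    g_tr: "\<And>i c. c \<in> {0, L} \<Longrightarrow> L2_lim (square_measure L) (\<lambda>n q. g n (face i c q)) (\<lambda>q. \<beta> (face i c q))"
    unfolding scalar_trace_def by blast
  have h_cont: "continuous_on UNIV h" and f_cont: "continuous_on UNIV (f n)" and g_cont: "continuous_on UNIV (g n)" for n
    using h f_der g_der by (auto intro!: has_derivative_continuous_on)
  have Hi_cont: "continuous_on UNIV (\<lambda>x. H x $ i)"
    by (intro continuous_intros H)
  have h_meas: "h \<in> borel_measurable (box_measure L)" and H_meas: "(\<lambda>x. H x $ i) \<in> borel_measurable (box_measure L)"
    using h_cont Hi_cont by (auto intro!: measurable_restrict_space1 simp: borel_measurable_continuous_onI)
  obtain C where C: "\<And>x. x \<in> space (box_measure L) \<Longrightarrow> \<bar>h x\<bar> \<le> C"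
    using continuous_on_imp_bounded_on[OF h_cont bounded_Omega[of L]]
    by (auto simp: space_restrict_space)
  obtain C' where C': "\<And>x. x \<in> space (box_measure L) \<Longrightarrow> \<bar>H x $ i\<bar> \<le> C'"
    using continuous_on_imp_bounded_on[OF Hi_cont bounded_Omega[of L]]
    by (auto simp: space_restrict_space)
  have hface: "continuous_on UNIV (\<lambda>q. h (face i c q))" for c
    by (rule continuous_on_compose2[OF h_cont continuous_on_face_snd]) simp
  have bnd: "(\<lambda>n. \<integral>q. h (face i c q) * f n (face i c q) * g n (face i c q) \<partial>square_measure L)
      \<longlonglongrightarrow> (\<integral>q. h (face i c q) * \<alpha> (face i c q) * \<beta> (face i c q) \<partial>square_measure L)"
    "integrable (square_measure L) (\<lambda>q. h (face i c q) * f n (face i c q) * g n (face i c q))"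
    "integrable (square_measure L) (\<lambda>q. h (face i c q) * \<alpha> (face i c q) * \<beta> (face i c q))"
    if c: "c \<in> {0, L}" for c n
  proof -
    have m: "(\<lambda>q. h (face i c q)) \<in> borel_measurable (square_measure L)"
      using hface by (auto intro!: measurable_restrict_space1 simp: borel_measurable_continuous_onI)
    obtain K where K: "\<And>q. q \<in> space (square_measure L) \<Longrightarrow> \<bar>h (face i c q)\<bar> \<le> K"
      using continuous_on_imp_bounded_on[OF hface[of c] bounded_square[of L]]
      by (metis Int_iff space_restrict_space)
    note lims = L2_lim_mult[OF f_tr[OF c, of i] g_tr[OF c, of i] m K]
    show "(\<lambda>n. \<integral>q. h (face i c q) * f n (face i c q) * g n (face i c q) \<partial>square_measure L)
      \<longlonglongrightarrow> (\<integral>q. h (face i c q) * \<alpha> (face i c q) * \<beta> (face i c q) \<partial>square_measure L)"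
      by (rule lims(1))
    show "integrable (square_measure L) (\<lambda>q. h (face i c q) * f n (face i c q) * g n (face i c q))"
      by (rule lims(2))
    show "integrable (square_measure L) (\<lambda>q. h (face i c q) * \<alpha> (face i c q) * \<beta> (face i c q))"
      by (rule lims(3))
  qed
  note l1 = L2_lim_mult[OF f g H_meas C']
  note l2 = L2_lim_mult[OF F[of i] g h_meas C]
  note l3 = L2_lim_mult[OF f G[of i] h_meas C]
  show i1: "integrable (box_measure L) (\<lambda>x. H x $ i * a x * b x)"
    by (rule l1(3))
  show i2: "integrable (box_measure L) (\<lambda>x. h x * A x $ i * b x)"
    by (rule l2(3))
  show i3: "integrable (box_measure L) (\<lambda>x. h x * a x * B x $ i)"
    by (rule l3(3))
  let ?l = "\<lambda>n. (\<integral>x. H x $ i * f n x * g n x \<partial>box_measure L) + (\<integral>x. h x * F n x $ i * g n x \<partial>box_measure L)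
      + (\<integral>x. h x * f n x * G n x $ i \<partial>box_measure L)"
  let ?r = "\<lambda>n. (\<integral>q. h (face i L q) * f n (face i L q) * g n (face i L q) \<partial>square_measure L)
      - (\<integral>q. h (face i 0 q) * f n (face i 0 q) * g n (face i 0 q) \<partial>square_measure L)"
  have eq: "?l n = ?r n" for n
  proof -
    let ?G = "\<lambda>x. (f n x * g n x) *\<^sub>R H x + (h x * g n x) *\<^sub>R F n x + (h x * f n x) *\<^sub>R G n x"
    have "((\<lambda>x. h x * f n x * g n x) has_derivative (\<lambda>k. ?G x \<bullet> k)) (at x)" for x
      by (rule derivative_eq_intros h f_der g_der refl)+ (simp add: inner_add_left algebra_simps)
    moreover have "continuous_on UNIV ?G"
      by (intro continuous_intros h_cont f_cont g_cont H F_cont G_cont)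
    ultimately have "(\<integral>x. ?G x $ i \<partial>box_measure L)
        = (\<integral>q. h (face i L q) * f n (face i L q) * g n (face i L q)
              - h (face i 0 q) * f n (face i 0 q) * g n (face i 0 q) \<partial>square_measure L)"
      by (rule integral_partial_box[OF _ _ L])
    also have "\<dots> = ?r n"
      by (intro Bochner_Integration.integral_diff bnd) auto
    also have "(\<integral>x. ?G x $ i \<partial>box_measure L)
        = (\<integral>x. H x $ i * f n x * g n x + h x * F n x $ i * g n x + h x * f n x * G n x $ i \<partial>box_measure L)"
      by (intro Bochner_Integration.integral_cong) (auto simp: algebra_simps)
    also have "\<dots> = ?l n"
      using l1(2)[of n] l2(2)[of n] l3(2)[of n] by simp
    finally show ?thesis .
  qed
  have "?l \<longlonglongrightarrow> (\<integral>x. H x $ i * a x * b x \<partial>box_measure L) + (\<integral>x. h x * A x $ i * b x \<partial>box_measure L)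
      + (\<integral>x. h x * a x * B x $ i \<partial>box_measure L)"
    by (intro tendsto_add l1(1) l2(1) l3(1))
  moreover have "?r \<longlonglongrightarrow> (\<integral>q. h (face i L q) * \<alpha> (face i L q) * \<beta> (face i L q) \<partial>square_measure L)
      - (\<integral>q. h (face i 0 q) * \<alpha> (face i 0 q) * \<beta> (face i 0 q) \<partial>square_measure L)"
    by (intro tendsto_diff bnd) auto
  ultimately have "(\<integral>x. H x $ i * a x * b x \<partial>box_measure L) + (\<integral>x. h x * A x $ i * b x \<partial>box_measure L)
      + (\<integral>x. h x * a x * B x $ i \<partial>box_measure L)
     = (\<integral>q. h (face i L q) * \<alpha> (face i L q) * \<beta> (face i L q) \<partial>square_measure L)
      - (\<integral>q. h (face i 0 q) * \<alpha> (face i 0 q) * \<beta> (face i 0 q) \<partial>square_measure L)"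
    unfolding eq by (rule LIMSEQ_unique)
  then show "(\<integral>x. H x $ i * a x * b x + h x * A x $ i * b x + h x * a x * B x $ i \<partial>box_measure L)
      = (\<integral>q. h (face i L q) * \<alpha> (face i L q) * \<beta> (face i L q)
              - h (face i 0 q) * \<alpha> (face i 0 q) * \<beta> (face i 0 q) \<partial>square_measure L)"
    using i1 i2 i3 bnd(3)[of 0] bnd(3)[of L] by simp
qed

section \<open>The wall layer\<close>

lemma has_derivative_nth3:
  fixes F F' :: "real \<Rightarrow> real"
  assumes "\<And>z. (F has_real_derivative F' z) (at z)"
  shows "((\<lambda>x :: real^3. F (x $ 3)) has_derivative (\<lambda>h. (F' (x $ 3) *\<^sub>R axis 3 1) \<bullet> h)) (at x)"
proof -
  have "((\<lambda>x :: real^3. x $ 3) has_derivative (\<lambda>h. h $ 3)) (at x)"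
    by (rule bounded_linear_imp_has_derivative) (rule bounded_linear_vec_nth)
  from has_derivative_compose[OF this assms[unfolded has_field_derivative_def]]
  show ?thesis
    by (simp add: inner_axis' mult.commute)
qed

lemma has_real_derivative_max_0_square:
  "((\<lambda>y. (max 0 y)\<^sup>2) has_real_derivative 2 * max 0 y) (at y)"
proof -
  consider "y > 0" | "y < 0" | "y = 0"
    by linarith
  then show ?thesis
  proof cases
    case 1
    have "((\<lambda>y. y\<^sup>2) has_real_derivative 2 * max 0 y) (at y)"
      using 1 by (auto intro!: derivative_eq_intros)
    then show ?thesis
      by (rule has_field_derivative_transform_within_open[of _ _ _ "{0<..}"]) (use 1 in auto)
  next
    case 2
    have "((\<lambda>y. 0) has_real_derivative 2 * max 0 y) (at y)"
      using 2 by (auto intro!: derivative_eq_intros)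
    then show ?thesis
      by (rule has_field_derivative_transform_within_open[of _ _ _ "{..<0}"]) (use 2 in auto)
  next
    case 3
    have "((\<lambda>h. max 0 h) \<longlongrightarrow> max 0 (0::real)) (at 0)"
      by (intro tendsto_intros)
    \<comment> \<open>The equality includes \<open>h = 0\<close>, where division by zero gives
      0.\<close>
    moreover have "(\<lambda>h. (max 0 h)\<^sup>2 / h) = (\<lambda>h. max 0 (h::real))"
      by (auto simp: fun_eq_iff max_def power2_eq_square)
    ultimately have "((\<lambda>h. (max 0 h)\<^sup>2 / h) \<longlongrightarrow> 0) (at (0::real))"
      by simp
    then show ?thesis
      using 3 by (simp add: has_field_derivative_iff)
  qed
qed

lemma power2_norm_matrix:
  fixes D :: "real^3^3"
  shows "(norm D)\<^sup>2 = (\<Sum>k\<in>UNIV. \<Sum>i\<in>UNIV. (D $ k $ i)\<^sup>2)"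
  unfolding power2_norm_eq_inner inner_vec_def by (simp add: power2_eq_square)

lemma measure_Omega: "L > 0 \<Longrightarrow> measure lborel (Omega L) = L ^ 3"
proof -
  assume "L > 0"
  have "measure lborel (Omega L) = (\<Prod>b\<in>Basis. ((\<chi> i. L) - 0 :: real^3) \<bullet> b)"
    unfolding Omega_def using \<open>L > 0\<close> by (intro measure_lborel_box) (auto simp: Basis_vec_def inner_axis)
  also have "\<dots> = L ^ 3"
    by (simp add: Basis_vec_def inner_axis UNION_singleton_eq_range prod.reindex inj_on_def axis_eq_axis)
  finally show ?thesis .
qed

lemma measure_square: "L > 0 \<Longrightarrow> measure lborel (square L) = L\<^sup>2"
  unfolding square_def by (subst measure_lborel_box) (auto simp: Basis_real2 power2_eq_square)

lemma measure_space_restrict_lborel: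
  assumes "S \<in> sets borel"
  shows "measure (restrict_space lborel S) (space (restrict_space lborel S)) = measure lborel S"
  using assms by (simp add: measure_restrict_space space_restrict_space)

lemma AE_square_measure: "(AE q in square_measure L. P q) \<longleftrightarrow> (AE q in lborel. q \<in> square L \<longrightarrow> P q)"
  by (subst AE_restrict_space_iff) auto

lemma AE_box_measure: "(AE x in box_measure L. P x) \<longleftrightarrow> (AE x in lborel. x \<in> Omega L \<longrightarrow> P x)"
  by (subst AE_restrict_space_iff) auto

lemma borel_measurable_box_measure_continuous:
  "continuous_on UNIV f \<Longrightarrow> f \<in> borel_measurable (box_measure L)"
  by (auto intro!: measurable_restrict_space1 simp: borel_measurable_continuous_onI)

section \<open>The comparison profile and the weighted Poincare inequality\<close>

locale wall_layer =
  fixes L U \<beta> :: real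
  assumes L: "L > 0" and U: "U > 0" and \<beta>: "\<beta> > 0" "\<beta> \<le> 1"
begin

text \<open>The normalized wall coordinate: 0 at the inner edge of the layer, 1 at the wall. It is
  kept apart from its positive part \<open>ramp\<close>, since \<zeta> is differentiable everywhere
  and \<open>ramp\<close> is not.\<close>

definition \<zeta> :: "real \<Rightarrow> real" where
  "\<zeta> z = (z - (1 - \<beta>) * L) / (\<beta> * L)"

definition ramp :: "real \<Rightarrow> real" where
  "ramp z = max 0 (\<zeta> z)"

definition \<phi>\<^sub>1 :: "real^3 \<Rightarrow> real" where
  "\<phi>\<^sub>1 x = U * (ramp (x $ 3))\<^sup>2"

text \<open>The derivative of \<open>\<phi>\<^sub>1\<close> normal to the wall. It has three roles:
  Frobenius norm of \<open>D\<phi>\<close>, weight in the convective term, and weight of the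
  Poincare inequality.\<close>

definition slope :: "real^3 \<Rightarrow> real" where
  "slope x = U * (2 * ramp (x $ 3) / (\<beta> * L))"

definition \<phi> :: "real^3 \<Rightarrow> real^3" where
  "\<phi> x = \<phi>\<^sub>1 x *\<^sub>R axis 1 1"

definition D\<phi> :: "real^3 \<Rightarrow> real^3^3" where
  "D\<phi> x = slope x *\<^sub>R axis 1 (axis 3 1)"

lemma nonzero [simp]: "L \<noteq> 0" "\<beta> \<noteq> 0"
  using L \<beta> by auto

lemma ramp_nonneg [simp]: "ramp z \<ge> 0"
  by (simp add: ramp_def)

lemma ramp_le_1: "z \<le> L \<Longrightarrow> ramp z \<le> 1"
  using L \<beta> by (simp add: ramp_def \<zeta>_def field_simps)

lemma ramp_L [simp]: "ramp L = 1" and \<zeta>_L [simp]: "\<zeta> L = 1"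
  using L \<beta> by (simp_all add: ramp_def \<zeta>_def field_simps)

lemma ramp_0 [simp]: "ramp 0 = 0"
  using L \<beta> by (simp add: ramp_def \<zeta>_def field_simps)

lemma ramp_pos_imp: "ramp z > 0 \<Longrightarrow> z > (1 - \<beta>) * L"
  using L \<beta> by (simp add: ramp_def \<zeta>_def field_simps max_def split: if_splits)

lemma \<zeta>_mult_ramp: "\<zeta> z * ramp z = (ramp z)\<^sup>2"
  by (simp add: ramp_def max_def power2_eq_square)

lemma \<zeta>_deriv: "(\<zeta> has_real_derivative 1 / (\<beta> * L)) (at z)"
  unfolding \<zeta>_def by (auto intro!: derivative_eq_intros)

lemma ramp_square_deriv: "((\<lambda>z. (ramp z)\<^sup>2) has_real_derivative 2 * ramp z / (\<beta> * L)) (at z)"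
  using DERIV_chain2[OF has_real_derivative_max_0_square \<zeta>_deriv] by (simp add: ramp_def)

lemma continuous_on_ramp: "continuous_on A ramp"
  unfolding ramp_def \<zeta>_def by (intro continuous_intros) auto

lemma continuous_on_ramp_nth: "continuous_on UNIV (\<lambda>x :: real^3. ramp (x $ 3))"
  by (rule continuous_on_compose2[OF continuous_on_ramp]) (auto intro!: continuous_intros)

lemma continuous_on_slope: "continuous_on UNIV slope"
  unfolding slope_def using L \<beta> by (intro continuous_intros continuous_on_ramp_nth) auto

lemma continuous_on_\<phi>\<^sub>1: "continuous_on UNIV \<phi>\<^sub>1"
  unfolding \<phi>\<^sub>1_def by (intro continuous_intros continuous_on_ramp_nth)

lemma slope_nonneg [simp]: "slope x \<ge> 0"
  using L U \<beta> by (simp add: slope_def)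

lemma slope_le:
  assumes "x \<in> Omega L"
  shows "slope x \<le> 2 * U / (\<beta> * L)"
proof -
  have "U * (2 * ramp (x $ 3) / (\<beta> * L)) \<le> U * (2 * 1 / (\<beta> * L))"
    using assms L U \<beta> ramp_le_1[of "x $ 3"]
    by (intro mult_left_mono divide_right_mono) (auto simp: mem_Omega less_imp_le)
  then show ?thesis
    by (simp add: slope_def mult.commute)
qed

lemma \<phi>\<^sub>1_le: "x \<in> Omega L \<Longrightarrow> \<bar>\<phi>\<^sub>1 x\<bar> \<le> U"
  using U ramp_le_1[of "x $ 3"] by (auto simp: \<phi>\<^sub>1_def mem_Omega power_le_one less_imp_le)

lemma \<phi>\<^sub>1_deriv: "(\<phi>\<^sub>1 has_derivative (\<lambda>h. (slope x *\<^sub>R axis 3 1) \<bullet> h)) (at x)"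
  unfolding \<phi>\<^sub>1_def slope_def
  by (rule has_derivative_nth3) (intro DERIV_cmult ramp_square_deriv)

lemma integrable_box_measure_const: "integrable (box_measure L) (\<lambda>_. c :: real)"
  by (rule integrable_continuous_bounded_set[OF continuous_on_const Omega_borel bounded_Omega])

text \<open>The integral of the normal derivative of \<kappa> times the square of \<open>a\<close>
  vanishes: at the upper wall the trace is zero, at the lower wall \<kappa> is zero, so
  \<open>a\<close> itself may be arbitrary there. Adding this null integral turns the claim into a
  pointwise inequality, proved by completing the square.\<close>

lemma poincare_wall:
  assumes a: "scalar_trace L a A \<alpha>" and wall: "AE q in square_measure L. \<alpha> (face 3 L q) = 0"
  shows "integrable (box_measure L) (\<lambda>x. slope x * (a x)\<^sup>2)"
    and "(\<integral>x. slope x * (a x)\<^sup>2 \<partial>box_measure L) \<le> U * \<beta> * L * (\<integral>x. (A x $ 3)\<^sup>2 \<partial>box_measure L)"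
proof -
  \<comment> \<open>In the variable \<open>r = ramp z\<close> this weight satisfies the Riccati inequality \<open>\<kappa>' - \<kappa>\<^sup>2 \<ge> 2 r\<close> on \<open>[0,1]\<close>.\<close>
  define \<kappa> where "\<kappa> z = (ramp z)\<^sup>2 + ((ramp z)\<^sup>2)\<^sup>2" for z
  define \<kappa>' where "\<kappa>' z = 2 * ramp z / (\<beta> * L) + 2 * (ramp z)\<^sup>2 * (2 * ramp z / (\<beta> * L))" for z
  have "(\<kappa> has_real_derivative \<kappa>' z) (at z)" for z
    unfolding \<kappa>_def \<kappa>'_def
    by (intro DERIV_add ramp_square_deriv DERIV_cong[OF DERIV_power[OF ramp_square_deriv, of 2]]) simp
  then have der: "((\<lambda>x :: real^3. \<kappa> (x $ 3)) has_derivative (\<lambda>h. (\<kappa>' (x $ 3) *\<^sub>R axis 3 1) \<bullet> h)) (at x)" for x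
    by (rule has_derivative_nth3)
  have cont: "continuous_on UNIV (\<lambda>x :: real^3. \<kappa>' (x $ 3) *\<^sub>R axis 3 (1::real))"
    unfolding \<kappa>'_def using L \<beta> by (intro continuous_intros continuous_on_ramp_nth) auto
  note ibp = integration_by_parts_box[OF a a der cont L, of 3]
  note int = integrable_by_parts_box[OF a a der cont L, of 3]
  have [measurable]: "a \<in> borel_measurable (box_measure L)"
    by (rule scalar_trace_L2[OF a])
  have slope_meas: "slope \<in> borel_measurable (box_measure L)"
    by (intro borel_measurable_box_measure_continuous continuous_on_slope)
  have "integrable (box_measure L) (\<lambda>x. slope x * a x * a x)"
    by (rule integrable_mult_square[OF _ _ slope_meas, of _ _ "2 * U / (\<beta> * L)"])
       (use scalar_trace_L2[OF a] slope_le in \<open>auto simp: space_restrict_space\<close>)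
  then show int_s: "integrable (box_measure L) (\<lambda>x. slope x * (a x)\<^sup>2)"
    by (simp add: power2_eq_square mult.assoc)
  have A2: "integrable (box_measure L) (\<lambda>x. (A x $ 3)\<^sup>2)"
    by (rule scalar_trace_L2[OF a])
  let ?I = "\<lambda>x. \<kappa>' (x $ 3) * a x * a x + \<kappa> (x $ 3) * A x $ 3 * a x + \<kappa> (x $ 3) * a x * A x $ 3"
  have I: "integrable (box_measure L) ?I"
    using int by (intro Bochner_Integration.integrable_add) simp_all
  have "(\<integral>q. \<kappa> (face 3 L q $ 3) * \<alpha> (face 3 L q) * \<alpha> (face 3 L q)
         - \<kappa> (face 3 0 q $ 3) * \<alpha> (face 3 0 q) * \<alpha> (face 3 0 q) \<partial>square_measure L) = 0"
    using wall by (intro integral_eq_zero_AE) (auto elim!: eventually_mono simp: \<kappa>_def)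
  with ibp have I0: "(\<integral>x. ?I x \<partial>box_measure L) = 0"
    by simp
  have pt: "slope x * (a x)\<^sup>2 \<le> U * ?I x + U * \<beta> * L * (A x $ 3)\<^sup>2" if x: "x \<in> Omega L" for x
  proof -
    define r where "r = ramp (x $ 3)"
    have r: "0 \<le> r" "r \<le> 1"
      using x ramp_le_1[of "x $ 3"] by (auto simp: r_def mem_Omega less_imp_le)
    \<comment> \<open>The Riccati inequality for \<kappa> reduces to this bound; equality at
      \<open>r = 1\<close> explains the 4, which is the coefficient of the cubic term in the
      derivative of \<kappa>.\<close>
    have "r * (1 + r\<^sup>2)\<^sup>2 \<le> 1 * (1 + 1)\<^sup>2"
      using r by (intro mult_mono power_mono add_mono) (auto simp: power_le_one)
    then have "0 \<le> r ^ 3 * (4 - r * (1 + r\<^sup>2)\<^sup>2)"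
      using r by simp
    also have "\<dots> = 4 * r ^ 3 - (r\<^sup>2 + (r\<^sup>2)\<^sup>2)\<^sup>2"
      by (simp add: power2_eq_square power3_eq_cube algebra_simps)
    \<comment> \<open>The second square absorbs the mixed term
      \<open>2 * \<kappa> * a * A $ 3\<close> of \<open>?I\<close> and the gradient term; the first
      summand is what the Riccati inequality leaves over.\<close>
    finally have "0 \<le> (4 * r ^ 3 - (\<kappa> (x $ 3))\<^sup>2) * (a x)\<^sup>2 + (\<kappa> (x $ 3) * a x + \<beta> * L * A x $ 3)\<^sup>2"
      by (simp add: \<kappa>_def r_def)
    then have "0 \<le> U / (\<beta> * L) * ((4 * r ^ 3 - (\<kappa> (x $ 3))\<^sup>2) * (a x)\<^sup>2 + (\<kappa> (x $ 3) * a x + \<beta> * L * A x $ 3)\<^sup>2)"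
      using U \<beta> L by simp
    also have "\<dots> = U * ?I x + U * \<beta> * L * (A x $ 3)\<^sup>2 - slope x * (a x)\<^sup>2"
      using \<beta> L by (simp add: \<kappa>'_def slope_def r_def[symmetric] field_simps power2_eq_square power3_eq_cube)
    finally show ?thesis
      by simp
  qed
  have "(\<integral>x. slope x * (a x)\<^sup>2 \<partial>box_measure L) \<le> (\<integral>x. U * ?I x + U * \<beta> * L * (A x $ 3)\<^sup>2 \<partial>box_measure L)"
    using int_s I A2 pt by (intro integral_mono) (auto simp: space_restrict_space)
  also have "\<dots> = U * \<beta> * L * (\<integral>x. (A x $ 3)\<^sup>2 \<partial>box_measure L)"
    using I A2 I0 by simp
  finally show "(\<integral>x. slope x * (a x)\<^sup>2 \<partial>box_measure L) \<le> U * \<beta> * L * (\<integral>x. (A x $ 3)\<^sup>2 \<partial>box_measure L)" .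
qed

lemma integral_slope_square:
  "integrable (box_measure L) (\<lambda>x. (slope x)\<^sup>2)"
  "(\<integral>x. (slope x)\<^sup>2 \<partial>box_measure L) = 4 / 3 * U\<^sup>2 * L / \<beta>"
proof -
  \<comment> \<open>\<open>c * \<zeta> * ramp\<^sup>2\<close> is an antiderivative of
    \<open>slope\<^sup>2\<close> in the third coordinate. Writing the cube of \<open>ramp\<close>
    with one factor \<zeta> makes the product rule applicable. At the wall the antiderivative equals
    \<open>c\<close>, at the bottom 0.\<close>
  define c where "c = 4 * U\<^sup>2 / (3 * \<beta> * L)"
  show "integrable (box_measure L) (\<lambda>x. (slope x)\<^sup>2)"
    by (intro integrable_continuous_bounded_set continuous_intros continuous_on_slope bounded_Omega Omega_borel)
  have "((\<lambda>z. c * (\<zeta> z * (ramp z)\<^sup>2)) has_real_derivative c * (3 * (ramp z)\<^sup>2 / (\<beta> * L))) (at z)" for z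
  proof (rule DERIV_cong[OF DERIV_cmult[OF DERIV_mult[OF \<zeta>_deriv ramp_square_deriv]]])
    have "2 * ramp z / (\<beta> * L) * \<zeta> z = 2 * (ramp z)\<^sup>2 / (\<beta> * L)"
      by (simp flip: \<zeta>_mult_ramp)
    then show "c * (1 / (\<beta> * L) * (ramp z)\<^sup>2 + 2 * ramp z / (\<beta> * L) * \<zeta> z) = c * (3 * (ramp z)\<^sup>2 / (\<beta> * L))"
      by (simp add: add_divide_distrib[symmetric])
  qed
  then have der: "((\<lambda>x :: real^3. c * (\<zeta> (x $ 3) * (ramp (x $ 3))\<^sup>2)) has_derivative
      (\<lambda>h. ((c * (3 * (ramp (x $ 3))\<^sup>2 / (\<beta> * L))) *\<^sub>R axis 3 1) \<bullet> h)) (at x)" for x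
    by (rule has_derivative_nth3)
  have cont: "continuous_on UNIV (\<lambda>x :: real^3. (c * (3 * (ramp (x $ 3))\<^sup>2 / (\<beta> * L))) *\<^sub>R axis 3 (1::real))"
    using L \<beta> by (intro continuous_intros continuous_on_ramp_nth) auto
  have "(\<integral>x. (slope x)\<^sup>2 \<partial>box_measure L)
      = (\<integral>x. ((c * (3 * (ramp (x $ 3))\<^sup>2 / (\<beta> * L))) *\<^sub>R axis 3 (1::real) :: real^3) $ 3 \<partial>box_measure L)"
    using L \<beta> by (intro Bochner_Integration.integral_cong) (auto simp: slope_def c_def field_simps power2_eq_square)
  also have "\<dots> = (\<integral>q. c * (\<zeta> (face 3 L q $ 3) * (ramp (face 3 L q $ 3))\<^sup>2)
       - c * (\<zeta> (face 3 0 q $ 3) * (ramp (face 3 0 q $ 3))\<^sup>2) \<partial>square_measure L)"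
    by (rule integral_partial_box[OF der cont L])
  also have "\<dots> = c * L\<^sup>2"
    using measure_space_restrict_lborel[OF square_borel, of L] measure_square[OF L] by simp
  also have "\<dots> = 4 / 3 * U\<^sup>2 * L / \<beta>"
    using L \<beta> by (simp add: c_def power2_eq_square)
  finally show "(\<integral>x. (slope x)\<^sup>2 \<partial>box_measure L) = 4 / 3 * U\<^sup>2 * L / \<beta>" .
qed

end

section \<open>Estimates for a single field with shear boundary values\<close>

lemma in_L2_box:
  assumes "in_L2 (Omega L) v"
  shows "v \<in> borel_measurable (box_measure L)" "integrable (box_measure L) (\<lambda>x. (norm (v x))\<^sup>2)"
  using assms by (auto simp: in_L2_def set_borel_measurable_restrict_lborel set_integrable_restrict_lborel)

lemma shear_bc_trace:
  assumes "shear_bc L U v D"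
  obtains g where "has_trace L v D g"
    "AE q in square_measure L. g (face 1 0 q) = g (face 1 L q) \<and> g (face 2 0 q) = g (face 2 L q) \<and>
       g (face 3 0 q) = 0 \<and> g (face 3 L q) = vector [U, 0, 0]"
  using assms unfolding shear_bc_def AE_square_measure by blast

lemma power2_entry_le_norm:
  fixes D :: "real^3^3"
  shows "(\<Sum>k\<in>UNIV. (D $ k $ 3)\<^sup>2) \<le> (norm D)\<^sup>2"
  unfolding power2_norm_matrix by (intro sum_mono member_le_sum) auto

lemma integral_square_le_norm:
  fixes D :: "real^3 \<Rightarrow> real^3^3"
  assumes "\<And>k. integrable (box_measure L) (\<lambda>x. (D x $ k $ 3)\<^sup>2)"
    and "integrable (box_measure L) (\<lambda>x. (norm (D x))\<^sup>2)"
  shows "(\<Sum>k\<in>UNIV. \<integral>x. (D x $ k $ 3)\<^sup>2 \<partial>box_measure L) \<le> (\<integral>x. (norm (D x))\<^sup>2 \<partial>box_measure L)"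
proof -
  have "(\<Sum>k\<in>UNIV. \<integral>x. (D x $ k $ 3)\<^sup>2 \<partial>box_measure L) = (\<integral>x. (\<Sum>k\<in>UNIV. (D x $ k $ 3)\<^sup>2) \<partial>box_measure L)"
    using assms by (subst Bochner_Integration.integral_sum) auto
  also have "\<dots> \<le> (\<integral>x. (norm (D x))\<^sup>2 \<partial>box_measure L)"
    using assms by (intro integral_mono power2_entry_le_norm) auto
  finally show ?thesis .
qed

context wall_layer
begin

lemma wall_trace_components:
  assumes tr: "has_trace L v D g"
    and bc: "AE q in square_measure L. g (face 1 0 q) = g (face 1 L q) \<and> g (face 2 0 q) = g (face 2 L q) \<and>
       g (face 3 0 q) = 0 \<and> g (face 3 L q) = vector [U, 0, 0]"
  shows "AE q in square_measure L. g (face 3 L q) $ k - (U *\<^sub>R axis 1 1 :: real^3) $ k = 0"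
  using bc
proof eventually_elim
  case (elim q)
  then have eq: "g (face 3 L q) = vector [U, 0, 0]"
    by simp
  consider "k = 1" | "k = 2" | "k = 3"
    using exhaust_3[of k] by blast
  then show ?case
    by cases (simp_all add: eq axis_def)
qed

lemma poincare_wall_vector:
  assumes L2: "in_L2 (Omega L) D" and bc: "shear_bc L U v D"
  shows "integrable (box_measure L) (\<lambda>x. slope x * (norm (v x - U *\<^sub>R axis 1 1))\<^sup>2)"
    and "(\<integral>x. slope x * (norm (v x - U *\<^sub>R axis 1 1))\<^sup>2 \<partial>box_measure L)
         \<le> U * \<beta> * L * (\<integral>x. (norm (D x))\<^sup>2 \<partial>box_measure L)"
proof -
  obtain g where tr: "has_trace L v D g" and
    g: "AE q in square_measure L. g (face 1 0 q) = g (face 1 L q) \<and> g (face 2 0 q) = g (face 2 L q) \<and>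
       g (face 3 0 q) = 0 \<and> g (face 3 L q) = vector [U, 0, 0]"
    using shear_bc_trace[OF bc] .
  let ?w = "\<lambda>k x. v x $ k - (U *\<^sub>R axis 1 1 :: real^3) $ k"
  have sc: "scalar_trace L (?w k) (\<lambda>x. D x $ k) (\<lambda>x. g x $ k - (U *\<^sub>R axis 1 1 :: real^3) $ k)" for k
    by (rule scalar_trace_component[OF tr])
  note p = poincare_wall[OF sc wall_trace_components[OF tr g]]
  have eq: "slope x * (norm (v x - U *\<^sub>R axis 1 1))\<^sup>2 = (\<Sum>k\<in>UNIV. slope x * (?w k x)\<^sup>2)" for x
    unfolding power2_norm_eq_inner inner_vec_def
    by (simp add: power2_eq_square sum_distrib_left)
  show "integrable (box_measure L) (\<lambda>x. slope x * (norm (v x - U *\<^sub>R axis 1 1))\<^sup>2)"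
    unfolding eq by (intro Bochner_Integration.integrable_sum p)
  have "(\<integral>x. slope x * (norm (v x - U *\<^sub>R axis 1 1))\<^sup>2 \<partial>box_measure L)
      = (\<Sum>k\<in>UNIV. \<integral>x. slope x * (?w k x)\<^sup>2 \<partial>box_measure L)"
    unfolding eq by (intro Bochner_Integration.integral_sum p)
  also have "\<dots> \<le> (\<Sum>k\<in>UNIV. U * \<beta> * L * (\<integral>x. (D x $ k $ 3)\<^sup>2 \<partial>box_measure L))"
    by (intro sum_mono p)
  also have "\<dots> \<le> U * \<beta> * L * (\<integral>x. (norm (D x))\<^sup>2 \<partial>box_measure L)"
    unfolding sum_distrib_left[symmetric]
    using U L \<beta> integral_square_le_norm[of L D] scalar_trace_L2(4)[OF sc] in_L2_box[OF L2]
    by (intro mult_left_mono) auto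
  finally show "(\<integral>x. slope x * (norm (v x - U *\<^sub>R axis 1 1))\<^sup>2 \<partial>box_measure L)
         \<le> U * \<beta> * L * (\<integral>x. (norm (D x))\<^sup>2 \<partial>box_measure L)" .
qed

lemma matrix_vector_inner_\<phi>: "(A *v y) \<bullet> \<phi> x = (\<Sum>i\<in>UNIV. \<phi>\<^sub>1 x * A $ 1 $ i * y $ i)"
  by (simp add: \<phi>_def inner_axis matrix_vector_mult_def sum_distrib_left mult.assoc)

lemma continuous_on_slope_axis: "continuous_on UNIV (\<lambda>x. slope x *\<^sub>R axis 3 (1::real) :: real^3)"
  by (intro continuous_intros continuous_on_slope)

text \<open>In each direction \<open>i\<close> the product of \<open>\<phi>\<^sub>1\<close>,
  \<open>v $ 1 - U\<close> and \<open>v $ i\<close> is integrated by parts. Shifting the first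
  component by \<open>U\<close> leaves its gradient unchanged and makes it vanish at the moving
  wall. Summed over \<open>i\<close>, the terms \<open>r\<close> carry the divergence and cancel;
  among the terms \<open>p\<close> only \<open>i = 3\<close> survives, because
  \<open>\<phi>\<^sub>1\<close> depends on the third coordinate alone.\<close>

lemma convective_bound:
  assumes L2: "in_L2 (Omega L) D" and div: "div_free_H1 (Omega L) D" and bc: "shear_bc L U v D"
  shows "(\<integral>x. (D x *v v x) \<bullet> \<phi> x \<partial>box_measure L) \<le> U * \<beta> * L / 2 * (\<integral>x. (norm (D x))\<^sup>2 \<partial>box_measure L)"
proof -
  obtain g where tr: "has_trace L v D g" and
    g: "AE q in square_measure L. g (face 1 0 q) = g (face 1 L q) \<and> g (face 2 0 q) = g (face 2 L q) \<and>
       g (face 3 0 q) = 0 \<and> g (face 3 L q) = vector [U, 0, 0]"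
    using shear_bc_trace[OF bc] .
  let ?a = "\<lambda>x. v x $ 1 - U"
  have a: "scalar_trace L ?a (\<lambda>x. D x $ 1) (\<lambda>x. g x $ 1 - U)"
    by (rule scalar_trace_component[OF tr])
  have b: "scalar_trace L (\<lambda>x. v x $ i) (\<lambda>x. D x $ i) (\<lambda>x. g x $ i)" for i
    using scalar_trace_component[OF tr, of i 0] by simp
  note ibp = integration_by_parts_box[OF a b \<phi>\<^sub>1_deriv continuous_on_slope_axis L]
  note int = integrable_by_parts_box[OF a b \<phi>\<^sub>1_deriv continuous_on_slope_axis L]
  define p q r where "p i x = (slope x *\<^sub>R axis 3 1 :: real^3) $ i * ?a x * v x $ i"
    and "q i x = \<phi>\<^sub>1 x * D x $ 1 $ i * v x $ i" and "r i x = \<phi>\<^sub>1 x * ?a x * D x $ i $ i" for i x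
  have ints: "integrable (box_measure L) (p i)" "integrable (box_measure L) (q i)" "integrable (box_measure L) (r i)" for i
    unfolding p_def q_def r_def using int[of i i] by blast+
  have pqr: "(\<integral>x. p i x + q i x + r i x \<partial>box_measure L) = 0" for i
  proof -
    have "(\<integral>q. \<phi>\<^sub>1 (face i L q) * (g (face i L q) $ 1 - U) * g (face i L q) $ i -
        \<phi>\<^sub>1 (face i 0 q) * (g (face i 0 q) $ 1 - U) * g (face i 0 q) $ i \<partial>square_measure L) = 0"
    \<comment> \<open>For \<open>i = 1, 2\<close> opposite faces cancel, since the traces are
      periodic and \<open>\<phi>\<^sub>1\<close> takes equal values there. For \<open>i = 3\<close>
      the lower face vanishes with \<open>\<phi>\<^sub>1\<close> and the upper one with the trace of
      \<open>v $ 1 - U\<close>.\<close>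
    proof (rule integral_eq_zero_AE, use g in eventually_elim)
      case (elim q)
      consider "i = 1" | "i = 2" | "i = 3"
        using exhaust_3[of i] by blast
      then show ?case
        using elim by cases (simp_all add: \<phi>\<^sub>1_def)
    qed
    then show ?thesis
      using ibp[of i i] by (simp add: p_def q_def r_def)
  qed
  have "(\<integral>x. p i x \<partial>box_measure L) + (\<integral>x. q i x \<partial>box_measure L) + (\<integral>x. r i x \<partial>box_measure L) = 0" for i
    using pqr[of i] ints[of i] by simp
  then have "(\<Sum>i\<in>UNIV. (\<integral>x. p i x \<partial>box_measure L) + (\<integral>x. q i x \<partial>box_measure L) + (\<integral>x. r i x \<partial>box_measure L)) = 0"
    by simp
  then have sum0: "(\<Sum>i\<in>UNIV. (\<integral>x. p i x \<partial>box_measure L)) + (\<Sum>i\<in>UNIV. (\<integral>x. q i x \<partial>box_measure L))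
      + (\<Sum>i\<in>UNIV. (\<integral>x. r i x \<partial>box_measure L)) = 0"
    by (simp add: sum.distrib)
  have "(\<Sum>i\<in>UNIV. (\<integral>x. r i x \<partial>box_measure L)) = (\<integral>x. (\<Sum>i\<in>UNIV. r i x) \<partial>box_measure L)"
    by (intro Bochner_Integration.integral_sum[symmetric] ints)
  also have "\<dots> = 0"
  proof (rule integral_eq_zero_AE)
    have "AE x in box_measure L. trace (D x) = 0"
      using div by (simp add: div_free_H1_def AE_box_measure)
    then show "AE x in box_measure L. (\<Sum>i\<in>UNIV. r i x) = 0"
      by eventually_elim (simp add: r_def trace_def sum_distrib_left[symmetric])
  qed
  finally have r0: "(\<Sum>i\<in>UNIV. (\<integral>x. r i x \<partial>box_measure L)) = 0" .
  have q: "(\<Sum>i\<in>UNIV. (\<integral>x. q i x \<partial>box_measure L)) = (\<integral>x. (D x *v v x) \<bullet> \<phi> x \<partial>box_measure L)"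
    unfolding matrix_vector_inner_\<phi> q_def[symmetric]
    by (intro Bochner_Integration.integral_sum[symmetric] ints)
  have p_eq: "p 1 = (\<lambda>_. 0)" "p 2 = (\<lambda>_. 0)" "p 3 = (\<lambda>x. slope x * ?a x * v x $ 3)"
    by (simp_all add: p_def axis_def fun_eq_iff)
  have "(\<Sum>i\<in>UNIV. (\<integral>x. p i x \<partial>box_measure L)) = (\<integral>x. slope x * ?a x * v x $ 3 \<partial>box_measure L)"
    by (simp add: sum_3 p_eq)
  with sum0 r0 q have eq: "(\<integral>x. (D x *v v x) \<bullet> \<phi> x \<partial>box_measure L) = - (\<integral>x. slope x * ?a x * v x $ 3 \<partial>box_measure L)"
    by simp
  note pw = poincare_wall_vector[OF L2 bc]
  have "- (slope x * ?a x * v x $ 3) \<le> 1 / 2 * (slope x * (norm (v x - U *\<^sub>R axis 1 1))\<^sup>2)" for x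
  proof -
    have "- (?a x * v x $ 3) \<le> ((?a x)\<^sup>2 + (v x $ 3)\<^sup>2) / 2"
      using abs_mult_le_half_squares[of "?a x" "v x $ 3"] by linarith
    also have "\<dots> \<le> (norm (v x - U *\<^sub>R axis 1 1))\<^sup>2 / 2"
      unfolding power2_norm_eq_inner inner_vec_def
      by (simp add: sum_3 axis_def power2_eq_square)
    finally have "slope x * - (?a x * v x $ 3) \<le> slope x * ((norm (v x - U *\<^sub>R axis 1 1))\<^sup>2 / 2)"
      by (rule mult_left_mono) simp
    then show ?thesis
      by (simp add: mult.assoc)
  qed
  moreover have "integrable (box_measure L) (\<lambda>x. slope x * ?a x * v x $ 3)"
    using ints(1)[of 3] by (simp add: p_eq)
  ultimately have "(\<integral>x. - (slope x * ?a x * v x $ 3) \<partial>box_measure L)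
      \<le> (\<integral>x. 1 / 2 * (slope x * (norm (v x - U *\<^sub>R axis 1 1))\<^sup>2) \<partial>box_measure L)"
    by (intro integral_mono integrable_minus integrable_mult_right pw)
  also have "\<dots> = 1 / 2 * (\<integral>x. slope x * (norm (v x - U *\<^sub>R axis 1 1))\<^sup>2 \<partial>box_measure L)"
    by simp
  finally show ?thesis
    using pw(2) eq by simp
qed

text \<open>The traces fix the mean of the normal derivative of the first component at
  \<open>U / L\<close>, and the tangent line to the square at that value bounds the squared gradient
  from below. This keeps the denominator of the effective viscosity away from zero.\<close>

lemma gradient_lower_bound:
  assumes L2: "in_L2 (Omega L) D" and bc: "shear_bc L U v D"
  shows "U\<^sup>2 * L \<le> (\<integral>x. (norm (D x))\<^sup>2 \<partial>box_measure L)"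
proof -
  obtain g where tr: "has_trace L v D g" and
    g: "AE q in square_measure L. g (face 1 0 q) = g (face 1 L q) \<and> g (face 2 0 q) = g (face 2 L q) \<and>
       g (face 3 0 q) = 0 \<and> g (face 3 L q) = vector [U, 0, 0]"
    using shear_bc_trace[OF bc] .
  have a: "scalar_trace L (\<lambda>x. v x $ 1) (\<lambda>x. D x $ 1) (\<lambda>x. g x $ 1)"
    using scalar_trace_component[OF tr, of 1 0] by simp
  have h: "((\<lambda>x. 1) has_derivative (\<lambda>k. 0 \<bullet> k)) (at x)" for x :: "real^3"
    by simp
  note ibp = integration_by_parts_box[OF a scalar_trace_const[of L 1] h continuous_on_const L, of 3]
  note int = integrable_by_parts_box[OF a scalar_trace_const[of L 1] h continuous_on_const L, of 3]
  have i1: "integrable (box_measure L) (\<lambda>x. D x $ 1 $ 3)"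
    using int(2) by simp
  have "(\<integral>x. D x $ 1 $ 3 \<partial>box_measure L) = (\<integral>q. g (face 3 L q) $ 1 - g (face 3 0 q) $ 1 \<partial>square_measure L)"
    using ibp by simp
  also have "\<dots> = (\<integral>q. U \<partial>square_measure L)"
  proof (rule integral_cong_AE)
    have "(\<lambda>q. g (face 3 c q) $ 1) \<in> borel_measurable (square_measure L)" if "c \<in> {0, L}" for c
      using a that by (auto simp: scalar_trace_def L2_lim_def)
    then show "(\<lambda>q. g (face 3 L q) $ 1 - g (face 3 0 q) $ 1) \<in> borel_measurable (square_measure L)"
      by (intro borel_measurable_diff) auto
    show "AE q in square_measure L. g (face 3 L q) $ 1 - g (face 3 0 q) $ 1 = U"
      using g by eventually_elim simp
  qed simp
  also have "\<dots> = U * L\<^sup>2"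
    using measure_space_restrict_lborel[OF square_borel, of L] measure_square[OF L] by simp
  finally have I: "(\<integral>x. D x $ 1 $ 3 \<partial>box_measure L) = U * L\<^sup>2" .
  have pt: "2 * U / L * D x $ 1 $ 3 - (U / L)\<^sup>2 \<le> (norm (D x))\<^sup>2" for x
  proof -
    have "2 * U / L * D x $ 1 $ 3 - (U / L)\<^sup>2 \<le> (D x $ 1 $ 3)\<^sup>2"
      using zero_le_power2[of "D x $ 1 $ 3 - U / L"] by (simp add: power2_diff algebra_simps)
    also have "\<dots> \<le> (\<Sum>k\<in>UNIV. (D x $ k $ 3)\<^sup>2)"
      by (rule member_le_sum[of 1 UNIV "\<lambda>k. (D x $ k $ 3)\<^sup>2"]) auto
    also have "\<dots> \<le> (norm (D x))\<^sup>2"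
      by (rule power2_entry_le_norm)
    finally show ?thesis .
  qed
  have "U\<^sup>2 * L = 2 * U / L * (U * L\<^sup>2) - (U / L)\<^sup>2 * L ^ 3"
    by (simp add: power2_eq_square power3_eq_cube)
  also have "\<dots> = (\<integral>x. 2 * U / L * D x $ 1 $ 3 - (U / L)\<^sup>2 \<partial>box_measure L)"
    using i1 I integrable_box_measure_const[of "(U / L)\<^sup>2"]
      measure_space_restrict_lborel[OF Omega_borel, of L] measure_Omega[OF L] by simp
  also have "\<dots> \<le> (\<integral>x. (norm (D x))\<^sup>2 \<partial>box_measure L)"
    using i1 integrable_box_measure_const[of "(U / L)\<^sup>2"] in_L2_box[OF L2] pt by (intro integral_mono) auto
  finally show ?thesis .
qed

section \<open>Admissibility of the comparison field in the energy inequality\<close>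

lemma \<phi>_has_derivative: "(\<phi> has_derivative (\<lambda>h. D\<phi> x *v h)) (at x)"
proof -
  have "(\<phi> has_derivative (\<lambda>h. ((slope x *\<^sub>R axis 3 1) \<bullet> h) *\<^sub>R axis 1 1)) (at x)"
    unfolding \<phi>_def by (intro has_derivative_scaleR_left \<phi>\<^sub>1_deriv)
  moreover have "D\<phi> x *v h = ((slope x *\<^sub>R axis 3 1) \<bullet> h) *\<^sub>R axis 1 1" for h
    by (simp add: vec_eq_iff forall_3 matrix_vector_mult_def D\<phi>_def axis_def inner_vec_def sum_3)
  ultimately show ?thesis
    by simp
qed

lemma continuous_on_\<phi>: "continuous_on UNIV \<phi>" and continuous_on_D\<phi>: "continuous_on UNIV D\<phi>"
  unfolding \<phi>_def D\<phi>_def by (intro continuous_intros continuous_on_\<phi>\<^sub>1 continuous_on_slope)+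

lemma norm_D\<phi>: "norm (D\<phi> x) = slope x"
  by (simp add: D\<phi>_def norm_eq_sqrt_inner inner_axis_axis)

lemma in_L2_continuous:
  fixes f :: "'a::euclidean_space \<Rightarrow> 'b::euclidean_space"
  assumes "continuous_on UNIV f" "S \<in> sets borel" "bounded S"
  shows "in_L2 S f"
  using assms
  by (auto simp: in_L2_def set_borel_measurable_restrict_lborel set_integrable_restrict_lborel
      intro!: measurable_restrict_space1 borel_measurable_continuous_onI integrable_continuous_bounded_set continuous_intros)

text \<open>The divergence theorem for \<open>\<phi> x $ k * \<psi> x\<close>: the faces lie outside
  the open box, where the test function is zero.\<close>

lemma weak_gradient_\<phi>: "weak_gradient (Omega L) \<phi> D\<phi>"
  unfolding weak_gradient_def
proof (intro allI impI)
  fix \<psi> :: "real^3 \<Rightarrow> real" and i k :: 3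
  assume \<psi>: "test_function (Omega L) \<psi>"
  then have "Ck (Suc 0) \<psi>"
    by (auto simp: test_function_def smooth_def)
  then have diff: "\<And>x. \<psi> differentiable (at x)" and cont: "\<And>h. continuous_on UNIV (\<lambda>x. frechet_derivative \<psi> (at x) h)"
    by auto
  have supp: "\<psi> x = 0" if "x \<notin> Omega L" for x
    using \<psi> that by (auto simp: test_function_def)
  define G where "G x = (\<chi> i. partial i \<psi> x)" for x
  have G: "(\<psi> has_derivative (\<lambda>h. G x \<bullet> h)) (at x)" for x
  proof -
    have "(\<psi> has_derivative frechet_derivative \<psi> (at x)) (at x)"
      using diff frechet_derivative_works by blast
    moreover have "frechet_derivative \<psi> (at x) = (\<lambda>h. G x \<bullet> h)"
    proof
      fix h :: "real^3"
      interpret linear "frechet_derivative \<psi> (at x)"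
        using diff by (rule linear_frechet_derivative)
      have "h = (\<Sum>i\<in>UNIV. h $ i *\<^sub>R axis i 1)"
        using basis_expansion[of h] by (simp add: scalar_mult_eq_scaleR)
      then have "frechet_derivative \<psi> (at x) h = (\<Sum>i\<in>UNIV. h $ i *\<^sub>R partial i \<psi> x)"
        using sum[of "\<lambda>i. h $ i *\<^sub>R axis i 1" UNIV] by (simp add: scaleR)
      then show "frechet_derivative \<psi> (at x) h = G x \<bullet> h"
        by (simp add: G_def inner_vec_def mult.commute)
    qed
    ultimately show ?thesis
      by simp
  qed
  have G_cont: "continuous_on UNIV G"
    unfolding G_def by (intro continuous_on_vec_lambda cont)
  have \<psi>_cont: "continuous_on UNIV \<psi>"
    using G by (auto intro!: has_derivative_continuous_on)
  have \<phi>k: "((\<lambda>x. \<phi> x $ k) has_derivative (\<lambda>h. D\<phi> x $ k \<bullet> h)) (at x)" for x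
    using bounded_linear.has_derivative[OF bounded_linear_vec_nth[of k] \<phi>_has_derivative[of x]]
    by (simp add: matrix_vector_mul_component)
  let ?H = "\<lambda>x. \<phi> x $ k *\<^sub>R G x + \<psi> x *\<^sub>R D\<phi> x $ k"
  have c1: "continuous_on UNIV (\<lambda>x. \<phi> x $ k * G x $ i)" and c2: "continuous_on UNIV (\<lambda>x. D\<phi> x $ k $ i * \<psi> x)"
    by (intro continuous_intros G_cont \<psi>_cont continuous_on_\<phi> continuous_on_D\<phi>)+
  have "((\<lambda>x. \<phi> x $ k * \<psi> x) has_derivative (\<lambda>h. ?H x \<bullet> h)) (at x)" for x
    by (rule derivative_eq_intros \<phi>k G refl)+ (simp add: inner_add_left mult.commute)
  moreover have "continuous_on UNIV ?H"
    by (intro continuous_intros G_cont \<psi>_cont continuous_on_\<phi> continuous_on_D\<phi>)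
  ultimately have "(\<integral>x. ?H x $ i \<partial>box_measure L)
      = (\<integral>q. \<phi> (face i L q) $ k * \<psi> (face i L q) - \<phi> (face i 0 q) $ k * \<psi> (face i 0 q) \<partial>square_measure L)"
    by (rule integral_partial_box[OF _ _ L])
  also have "\<dots> = 0"
    by (simp add: supp face_mem_Omega)
  finally have "(\<integral>x. \<phi> x $ k * G x $ i + D\<phi> x $ k $ i * \<psi> x \<partial>box_measure L) = 0"
    by (simp add: mult.commute)
  then have "(\<integral>x. \<phi> x $ k * G x $ i \<partial>box_measure L) + (\<integral>x. D\<phi> x $ k $ i * \<psi> x \<partial>box_measure L) = 0"
    by (subst (asm) Bochner_Integration.integral_add)
       (auto intro!: integrable_continuous_bounded_set c1 c2 bounded_Omega)
  then show "(LINT x:Omega L|lborel. \<phi> x $ k * partial i \<psi> x) = - (LINT x:Omega L|lborel. D\<phi> x $ k $ i * \<psi> x)"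
    by (simp add: integral_restrict_lborel G_def)
qed

lemma in_H1_\<phi>: "in_H1 (Omega L) \<phi> D\<phi>"
  unfolding in_H1_def
  by (intro conjI in_L2_continuous weak_gradient_\<phi> continuous_on_\<phi> continuous_on_D\<phi> bounded_Omega Omega_borel)

lemma div_free_\<phi>: "div_free_H1 (Omega L) D\<phi>"
  by (simp add: div_free_H1_def trace_def sum_3 D\<phi>_def axis_def)

text \<open>Since \<phi> is continuously differentiable, the constant sequence is an approximating
  sequence for it and \<phi> is its own trace.\<close>

lemma shear_bc_\<phi>: "shear_bc L U \<phi> D\<phi>"
proof -
  have zero: "L2_tendsto S (\<lambda>n. f) f" if "S \<in> sets borel" "bounded S" for S :: "'a::euclidean_space set" and f :: "'a \<Rightarrow> 'b::euclidean_space"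
    using in_L2_continuous[OF continuous_on_const that, of "0::'b"] by (simp add: L2_tendsto_def)
  have "has_trace L \<phi> D\<phi> \<phi>"
    unfolding has_trace_def
    by (intro exI[of _ "\<lambda>n. \<phi>"] exI[of _ "\<lambda>n. D\<phi>"] conjI allI ballI \<phi>_has_derivative continuous_on_D\<phi>
        zero Omega_borel bounded_Omega square_borel bounded_square)
  moreover have "\<phi> (face 3 L q) = vector [U, 0, 0]" for q
    by (simp add: \<phi>_def \<phi>\<^sub>1_def vec_eq_iff forall_3 axis_def)
  ultimately show ?thesis
    unfolding shear_bc_def by (intro exI[of _ \<phi>]) (simp add: \<phi>_def \<phi>\<^sub>1_def)
qed

end

section \<open>The ensemble\<close>

abbreviation time_measure :: "real \<Rightarrow> real measure" where
  "time_measure T \<equiv> restrict_space lborel {0..T}"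

abbreviation space_time :: "real \<Rightarrow> real \<Rightarrow> (real \<times> (real^3)) measure" where
  "space_time T L \<equiv> restrict_space lborel ({0..T} \<times> Omega L)"

lemma space_time_borel [simp]: "A \<in> sets borel \<Longrightarrow> A \<times> Omega L \<in> sets borel"
  by (rule borel_Times) auto

lemma fubini_space_time:
  fixes f :: "real \<times> (real^3) \<Rightarrow> real"
  assumes "integrable (space_time T L) f"
  shows "AE t in time_measure T. integrable (box_measure L) (\<lambda>x. f (t, x))"
    and "integrable (time_measure T) (\<lambda>t. \<integral>x. f (t, x) \<partial>box_measure L)"
proof -
  define k where "k p = indicator ({0..T} \<times> Omega L) p *\<^sub>R f p" for p
  have k: "integrable (lborel \<Otimes>\<^sub>M lborel) k"
    using assms unfolding k_def lborel_prod
    by (simp add: set_integrable_def flip: set_integrable_restrict_lborel)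
  have k_eq: "k (t, x) = indicator {0..T} t *\<^sub>R (indicator (Omega L) x *\<^sub>R f (t, x))" for t x
    by (simp add: k_def indicator_times)
  have "AE t in lborel. t \<in> {0..T} \<longrightarrow> integrable (box_measure L) (\<lambda>x. f (t, x))"
    using lborel_pair.AE_integrable_fst'[OF k]
  proof eventually_elim
    case (elim t)
    then show ?case
      by (auto simp: k_eq set_integrable_def simp flip: set_integrable_restrict_lborel)
  qed
  then show "AE t in time_measure T. integrable (box_measure L) (\<lambda>x. f (t, x))"
    by (subst AE_restrict_space_iff) auto
  have "(\<integral>x. k (t, x) \<partial>lborel) = indicator {0..T} t *\<^sub>R (\<integral>x. f (t, x) \<partial>box_measure L)" for t
    by (simp add: k_eq set_lebesgue_integral_def flip: integral_restrict_lborel)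
  then show "integrable (time_measure T) (\<lambda>t. \<integral>x. f (t, x) \<partial>box_measure L)"
    using lborel_pair.integrable_fst'[OF k]
    by (simp add: set_integrable_def flip: set_integrable_restrict_lborel)
qed

text \<open>Tonelli with a time-uniform bound on the slices. It turns the bound on the kinetic
  energy over a finite time interval into integrability of the squared velocity over
  space-time.\<close>

lemma integrable_space_time_of_bounded:
  fixes f :: "real \<times> (real^3) \<Rightarrow> real"
  assumes meas: "f \<in> borel_measurable (space_time T L)" and nonneg: "\<And>p. f p \<ge> 0"
    and int: "\<And>t. t \<in> {0..T} \<Longrightarrow> integrable (box_measure L) (\<lambda>x. f (t, x))"
    and bound: "\<And>t. t \<in> {0..T} \<Longrightarrow> (\<integral>x. f (t, x) \<partial>box_measure L) \<le> C"
  shows "integrable (space_time T L) f"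
proof -
  define k where "k p = indicator ({0..T} \<times> Omega L) p *\<^sub>R f p" for p
  have k_meas [measurable]: "k \<in> borel_measurable (lborel \<Otimes>\<^sub>M lborel)"
    using meas unfolding k_def lborel_prod
    by (simp add: set_borel_measurable_def flip: set_borel_measurable_restrict_lborel)
  have k_eq: "k (t, x) = indicator {0..T} t *\<^sub>R (indicator (Omega L) x *\<^sub>R f (t, x))" for t x
    by (simp add: k_def indicator_times)
  have slice: "(\<integral>x. norm (k (t, x)) \<partial>lborel) = indicator {0..T} t *\<^sub>R (\<integral>x. f (t, x) \<partial>box_measure L)" for t
    using nonneg by (simp add: k_eq set_lebesgue_integral_def abs_mult flip: integral_restrict_lborel)
  have "integrable lborel (\<lambda>t. \<integral>x. norm (k (t, x)) \<partial>lborel)"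
  proof (rule Bochner_Integration.integrable_bound)
    show "integrable lborel (\<lambda>t. indicator {0..T} t *\<^sub>R C)"
      by (intro borel_integrable_compact) auto
    show "(\<lambda>t. \<integral>x. norm (k (t, x)) \<partial>lborel) \<in> borel_measurable lborel"
      by measurable
    have "0 \<le> (\<integral>x. f (t, x) \<partial>box_measure L)" for t
      using nonneg by (intro integral_nonneg_AE) auto
    then show "AE t in lborel. norm (\<integral>x. norm (k (t, x)) \<partial>lborel) \<le> norm (indicator {0..T} t *\<^sub>R C)"
      unfolding slice using bound by (auto simp: indicator_def intro: order_trans[OF _ abs_ge_self])
  qed
  moreover have "integrable lborel (\<lambda>x. k (t, x))" for t
    using int[of t] by (cases "t \<in> {0..T}")
      (auto simp: k_eq set_integrable_def simp flip: set_integrable_restrict_lborel)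
  ultimately have "integrable (lborel \<Otimes>\<^sub>M lborel) k"
    by (intro lborel_pair.Fubini_integrable) auto
  then show ?thesis
    unfolding k_def lborel_prod by (simp add: set_integrable_def flip: set_integrable_restrict_lborel)
qed

lemma fluct_sq_nonneg: "fluct_sq J u t x \<ge> 0"
  by (simp add: fluct_sq_def ens_avg_def sum_nonneg)

text \<open>With \<open>c\<close> the velocity of the upper wall, the right-hand side only involves fields of vanishing trace
  there, and no averages of traces are needed.\<close>

lemma fluct_sq_le:
  assumes "J \<ge> 1"
  shows "fluct_sq J u t x \<le> ens_avg J (\<lambda>j. (norm (u j t x - c))\<^sup>2)"
proof -
  define m where "m = ens_avg J (\<lambda>k. u k t x)"
  have "(\<Sum>j=1..J. u j t x) = real J *\<^sub>R m"
    using assms by (simp add: m_def ens_avg_def)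
  then have "(\<Sum>j=1..J. (u j t x - m)) = 0"
    unfolding sum_subtractf sum_constant_scaleR by simp
  \<comment> \<open>Cross terms of the variance identity: deviations from the mean sum to zero,
    hence the mean minimizes the averaged squared distance.\<close>
  then have z: "(\<Sum>j=1..J. (u j t x - m) \<bullet> (m - c)) = 0"
    by (simp flip: inner_sum_left)
  have "(norm (u j t x - m))\<^sup>2 + 2 * ((u j t x - m) \<bullet> (m - c)) \<le> (norm (u j t x - c))\<^sup>2" for j
  proof -
    have "(norm (a + b))\<^sup>2 = (norm a)\<^sup>2 + 2 * (a \<bullet> b) + (norm b)\<^sup>2" for a b :: "real^3"
      by (simp add: power2_norm_eq_inner inner_add_left inner_add_right inner_commute)
    from this[of "u j t x - m" "m - c"]
    show ?thesis
      by simp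
  qed
  then have "(\<Sum>j=1..J. (norm (u j t x - m))\<^sup>2 + 2 * ((u j t x - m) \<bullet> (m - c))) \<le> (\<Sum>j=1..J. (norm (u j t x - c))\<^sup>2)"
    by (intro sum_mono)
  with z have "(\<Sum>j=1..J. (norm (u j t x - m))\<^sup>2) \<le> (\<Sum>j=1..J. (norm (u j t x - c))\<^sup>2)"
    by (simp add: sum.distrib sum_distrib_left[symmetric])
  then show ?thesis
    by (simp add: fluct_sq_def ens_avg_def m_def divide_right_mono)
qed

lemma near_wall_borel [measurable, simp]: "near_wall L \<beta> \<in> sets borel"
  unfolding near_wall_def by measurable

text \<open>No sign of \<beta> is assumed here: the results of this locale are the ones from which
  positivity of \<open>\<nu>\<^sub>e\<close>, and hence of \<beta>, is derived. Only then can the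
  wall layer be added.\<close>

locale ensemble =
  fixes L U \<nu> \<tau> \<mu>\<^sub>0 \<mu>\<^sub>\<beta> \<beta> :: real and J :: nat and \<mu> :: "real^3 \<Rightarrow> real"
    and u0 :: "nat \<Rightarrow> real^3 \<Rightarrow> real^3"
    and u :: "nat \<Rightarrow> real \<Rightarrow> real^3 \<Rightarrow> real^3"
    and Du :: "nat \<Rightarrow> real \<Rightarrow> real^3 \<Rightarrow> real^3^3"
    and \<nu>\<^sub>t :: "real \<Rightarrow> real^3 \<Rightarrow> real"
  assumes pos: "L > 0" "U > 0" "\<nu> > 0" "\<tau> > 0"
    and J: "J \<ge> 1"
    and nu_turb: "\<nu>\<^sub>t = eddy_viscosity J \<tau> \<mu> u"
    and solution: "\<And>j. j \<in> {1..J} \<Longrightarrow> weak_solution L U \<nu> \<nu>\<^sub>t (u0 j) (u j) (Du j)"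
    and energy: "\<And>j. j \<in> {1..J} \<Longrightarrow> energy_inequality L U \<nu> \<nu>\<^sub>t (u j) (Du j)"
    and mu_pos: "\<mu>\<^sub>0 > 0" "\<mu>\<^sub>\<beta> > 0"
    and mu_interior: "\<And>x. x \<in> Omega L - near_wall L \<beta> \<Longrightarrow> \<mu> x = \<mu>\<^sub>0"
    and mu_wall: "\<And>x. x \<in> near_wall L \<beta> \<Longrightarrow> \<mu> x = \<mu>\<^sub>\<beta>"
begin

lemma mu_eq: "x \<in> Omega L \<Longrightarrow> \<mu> x = (if x \<in> near_wall L \<beta> then \<mu>\<^sub>\<beta> else \<mu>\<^sub>0)"
  using mu_interior mu_wall by auto

lemma nu_t_nonneg: "x \<in> Omega L \<Longrightarrow> \<nu>\<^sub>t t x \<ge> 0"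
  using mu_pos pos fluct_sq_nonneg by (auto simp: nu_turb eddy_viscosity_def mu_eq)

lemma measurable_u:
  assumes "j \<in> {1..J}"
  shows "(\<lambda>p. u j (fst p) (snd p)) \<in> borel_measurable (space_time T L)"
    and "(\<lambda>p. Du j (fst p) (snd p)) \<in> borel_measurable (space_time T L)"
proof -
  have sub: "{0..T} \<times> Omega L \<subseteq> {0..} \<times> Omega L"
    by auto
  have "set_borel_measurable lborel ({0..} \<times> Omega L) (\<lambda>p. u j (fst p) (snd p))"
    "set_borel_measurable lborel ({0..} \<times> Omega L) (\<lambda>p. Du j (fst p) (snd p))"
    using solution[OF assms] by (simp_all add: weak_solution_def case_prod_unfold)
  from this[THEN set_borel_measurable_subset, OF _ sub]
  show "(\<lambda>p. u j (fst p) (snd p)) \<in> borel_measurable (space_time T L)"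
    and "(\<lambda>p. Du j (fst p) (snd p)) \<in> borel_measurable (space_time T L)"
    by (simp_all add: set_borel_measurable_restrict_lborel)
qed

lemma measurable_nu_t: "(\<lambda>p. \<nu>\<^sub>t (fst p) (snd p)) \<in> borel_measurable (space_time T L)"
proof -
  note measurable_u(1)[measurable]
  have [measurable]: "(\<lambda>p. fluct_sq J u (fst p) (snd p)) \<in> borel_measurable (space_time T L)"
    unfolding fluct_sq_def ens_avg_def by measurable
  have [measurable]: "snd \<in> borel_measurable (space_time T L)"
    by (intro measurable_restrict_space1) (simp add: borel_prod[symmetric])
  \<comment> \<open>The hypotheses determine \<mu> only on the box and the wall region, so
    measurability is shown for the two-valued function that agrees with it on the box.\<close>
  have "(\<lambda>p. (if snd p \<in> near_wall L \<beta> then \<mu>\<^sub>\<beta> else \<mu>\<^sub>0) * \<tau> * fluct_sq J u (fst p) (snd p))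
      \<in> borel_measurable (space_time T L)"
    by measurable
  then show ?thesis
    by (rule measurable_cong[THEN iffD1, rotated])
       (auto simp: nu_turb eddy_viscosity_def mu_eq space_restrict_space)
qed

lemma integrable_space_time:
  assumes j: "j \<in> {1..J}" and T: "T > 0"
  shows "integrable (space_time T L) (\<lambda>p. (norm (Du j (fst p) (snd p)))\<^sup>2)"
    and "integrable (space_time T L) (\<lambda>p. \<nu>\<^sub>t (fst p) (snd p) * (norm (Du j (fst p) (snd p)))\<^sup>2)"
    and "integrable (space_time T L) (\<lambda>p. (norm (u j (fst p) (snd p)))\<^sup>2)"
proof -
  have "set_integrable lborel ({0..T} \<times> Omega L) (\<lambda>p. (norm (Du j (fst p) (snd p)))\<^sup>2)"
    "set_integrable lborel ({0..T} \<times> Omega L) (\<lambda>p. \<nu>\<^sub>t (fst p) (snd p) * (norm (Du j (fst p) (snd p)))\<^sup>2)"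
    using solution[OF j] T by (simp_all add: weak_solution_def case_prod_unfold)
  then show "integrable (space_time T L) (\<lambda>p. (norm (Du j (fst p) (snd p)))\<^sup>2)"
    and "integrable (space_time T L) (\<lambda>p. \<nu>\<^sub>t (fst p) (snd p) * (norm (Du j (fst p) (snd p)))\<^sup>2)"
    by (simp_all add: set_integrable_restrict_lborel)
  have "\<exists>C. \<forall>t\<in>{0..T}. (LINT x:Omega L|lborel. (norm (u j t x))\<^sup>2) \<le> C"
    using solution[OF j] T by (simp add: weak_solution_def)
  then obtain C where C: "\<And>t. t \<in> {0..T} \<Longrightarrow> (LINT x:Omega L|lborel. (norm (u j t x))\<^sup>2) \<le> C"
    by blast
  have "in_L2 (Omega L) (u j t)" if "t \<in> {0..T}" for t
    using solution[OF j] that by (simp add: weak_solution_def)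
  note L2 = in_L2_box(2)[OF this]
  note measurable_u(1)[OF j, measurable]
  show "integrable (space_time T L) (\<lambda>p. (norm (u j (fst p) (snd p)))\<^sup>2)"
    using L2 C by (intro integrable_space_time_of_bounded[of _ _ _ C]) (auto simp: integral_restrict_lborel)
qed

text \<open>Taking \<open>c = 0\<close> in \<open>fluct_sq_le\<close> bounds the eddy viscosity by a
  multiple of the ensemble mean of the squared velocity. Together with boundedness of
  \<open>D\<phi>\<close> on the box this makes the viscous term of the energy inequality
  integrable.\<close>

lemma integrable_nu_t:
  assumes T: "T > 0"
  shows "integrable (space_time T L) (\<lambda>p. \<nu>\<^sub>t (fst p) (snd p))"
proof (rule Bochner_Integration.integrable_bound)
  let ?K = "max \<mu>\<^sub>0 \<mu>\<^sub>\<beta> * \<tau>"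
  show "integrable (space_time T L) (\<lambda>p. ?K * ens_avg J (\<lambda>j. (norm (u j (fst p) (snd p) - 0))\<^sup>2))"
    unfolding ens_avg_def using integrable_space_time(3)[OF _ T]
    by (intro integrable_mult_right integrable_scaleR_right Bochner_Integration.integrable_sum) simp
  have "\<nu>\<^sub>t t x \<le> ?K * ens_avg J (\<lambda>j. (norm (u j t x - 0))\<^sup>2)" if "x \<in> Omega L" for t x
    unfolding nu_turb eddy_viscosity_def using that mu_pos pos
    by (intro mult_mono fluct_sq_le J fluct_sq_nonneg) (auto simp: mu_eq)
  then show "AE p in space_time T L. norm (\<nu>\<^sub>t (fst p) (snd p))
      \<le> norm (?K * ens_avg J (\<lambda>j. (norm (u j (fst p) (snd p) - 0))\<^sup>2))"
    using nu_t_nonneg by (intro AE_I2) (force simp: space_restrict_space intro: order_trans[OF _ abs_ge_self])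
qed (rule measurable_nu_t)

end

section \<open>Ensemble averages and regular times\<close>

lemma ens_avg_mono: "(\<And>j. j \<in> {1..J} \<Longrightarrow> f j \<le> g j) \<Longrightarrow> ens_avg J f \<le> ens_avg J (g :: nat \<Rightarrow> real)"
  by (auto simp: ens_avg_def intro!: divide_right_mono sum_mono)

lemma ens_avg_add: "ens_avg J (\<lambda>j. f j + g j) = ens_avg J f + (ens_avg J g :: real)"
  by (simp add: ens_avg_def sum.distrib add_divide_distrib)

lemma ens_avg_mult: "ens_avg J (\<lambda>j. c * f j) = c * (ens_avg J f :: real)"
  by (simp add: ens_avg_def sum_distrib_left)

lemma ens_avg_divide: "ens_avg J (\<lambda>j. f j / c) = ens_avg J f / (c :: real)"
  by (simp add: ens_avg_def sum_divide_distrib mult.commute)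

lemma ens_avg_const: "J \<ge> 1 \<Longrightarrow> ens_avg J (\<lambda>j. c) = (c :: real)"
  by (simp add: ens_avg_def)

lemma integrable_ens_avg:
  fixes f :: "nat \<Rightarrow> 'a \<Rightarrow> real"
  shows "(\<And>j. j \<in> {1..J} \<Longrightarrow> integrable M (f j)) \<Longrightarrow> integrable M (\<lambda>x. ens_avg J (\<lambda>j. f j x))"
  unfolding ens_avg_def by (intro integrable_scaleR_right Bochner_Integration.integrable_sum)

lemma integral_ens_avg:
  fixes f :: "nat \<Rightarrow> 'a \<Rightarrow> real"
  shows "(\<And>j. j \<in> {1..J} \<Longrightarrow> integrable M (f j)) \<Longrightarrow>
    (\<integral>x. ens_avg J (\<lambda>j. f j x) \<partial>M) = ens_avg J (\<lambda>j. \<integral>x. f j x \<partial>M)"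
  unfolding ens_avg_def by (simp add: Bochner_Integration.integral_sum)

context ensemble
begin

definition grad_sq :: "nat \<Rightarrow> real \<Rightarrow> real" where
  "grad_sq j t = (\<integral>x. (norm (Du j t x))\<^sup>2 \<partial>box_measure L)"

definition dissipation :: "nat \<Rightarrow> real \<Rightarrow> real" where
  "dissipation j t = (\<integral>x. (\<nu> + \<nu>\<^sub>t t x) * (norm (Du j t x))\<^sup>2 \<partial>box_measure L)"

text \<open>Times at which all realizations are simultaneously good; the ensemble is finite, so
  almost every time qualifies.\<close>

definition regular :: "real \<Rightarrow> bool" where
  "regular t \<longleftrightarrow>
     (\<forall>j\<in>{1..J}. in_H1 (Omega L) (u j t) (Du j t) \<and> div_free_H1 (Omega L) (Du j t) \<and>
        shear_bc L U (u j t) (Du j t) \<and>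
        integrable (box_measure L) (\<lambda>x. (\<nu> + \<nu>\<^sub>t t x) * (norm (Du j t x))\<^sup>2))"

lemma integrable_total_viscosity:
  assumes "j \<in> {1..J}" "T > 0"
  shows "integrable (space_time T L) (\<lambda>p. (\<nu> + \<nu>\<^sub>t (fst p) (snd p)) * (norm (Du j (fst p) (snd p)))\<^sup>2)"
  unfolding distrib_right using integrable_space_time[OF assms] by simp

lemma AE_regular:
  assumes T: "T > 0"
  shows "AE t in time_measure T. regular t"
  unfolding regular_def
proof (subst AE_finite_all)
  show "\<forall>j\<in>{1..J}. AE t in time_measure T. in_H1 (Omega L) (u j t) (Du j t) \<and> div_free_H1 (Omega L) (Du j t) \<and>
        shear_bc L U (u j t) (Du j t) \<and>
        integrable (box_measure L) (\<lambda>x. (\<nu> + \<nu>\<^sub>t t x) * (norm (Du j t x))\<^sup>2)"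
  proof
    fix j assume j: "j \<in> {1..J}"
    have "AE t in lborel. 0 \<le> t \<longrightarrow> in_H1 (Omega L) (u j t) (Du j t) \<and> div_free_H1 (Omega L) (Du j t) \<and>
        shear_bc L U (u j t) (Du j t)"
      using solution[OF j] by (simp add: weak_solution_def)
    then have "AE t in time_measure T. in_H1 (Omega L) (u j t) (Du j t) \<and> div_free_H1 (Omega L) (Du j t) \<and>
        shear_bc L U (u j t) (Du j t)"
      by (subst AE_restrict_space_iff) (auto elim: eventually_mono)
    moreover have "AE t in time_measure T. integrable (box_measure L) (\<lambda>x. (\<nu> + \<nu>\<^sub>t t x) * (norm (Du j t x))\<^sup>2)"
      using fubini_space_time(1)[OF integrable_total_viscosity[OF j T]] by simp
    ultimately show "AE t in time_measure T. in_H1 (Omega L) (u j t) (Du j t) \<and> div_free_H1 (Omega L) (Du j t) \<and>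
        shear_bc L U (u j t) (Du j t) \<and>
        integrable (box_measure L) (\<lambda>x. (\<nu> + \<nu>\<^sub>t t x) * (norm (Du j t x))\<^sup>2)"
      by eventually_elim blast
  qed
qed simp

lemma integrable_grad_sq: "j \<in> {1..J} \<Longrightarrow> T > 0 \<Longrightarrow> integrable (time_measure T) (grad_sq j)"
  and integrable_dissipation: "j \<in> {1..J} \<Longrightarrow> T > 0 \<Longrightarrow> integrable (time_measure T) (dissipation j)"
  using fubini_space_time(2)[OF integrable_space_time(1)] fubini_space_time(2)[OF integrable_total_viscosity]
  by (simp_all add: grad_sq_def[abs_def] dissipation_def[abs_def])

lemma grad_sq_ge:
  assumes "regular t" "j \<in> {1..J}"
  shows "U\<^sup>2 * L \<le> grad_sq j t"
proof -
  \<comment> \<open>The bound does not involve the layer thickness, so any admissible value serves,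
    and none has to be known for \<beta>.\<close>
  interpret wall_layer L U 1
    using pos by unfold_locales auto
  show ?thesis
    using assms unfolding grad_sq_def regular_def in_H1_def by (intro gradient_lower_bound) auto
qed

lemma dissipation_ge:
  assumes "regular t" "j \<in> {1..J}"
  shows "\<nu> * grad_sq j t \<le> dissipation j t"
proof -
  have "in_L2 (Omega L) (Du j t)" and int: "integrable (box_measure L) (\<lambda>x. (\<nu> + \<nu>\<^sub>t t x) * (norm (Du j t x))\<^sup>2)"
    using assms by (auto simp: regular_def in_H1_def)
  then have "(\<integral>x. \<nu> * (norm (Du j t x))\<^sup>2 \<partial>box_measure L) \<le> dissipation j t"
    unfolding dissipation_def using nu_t_nonneg
    by (intro integral_mono int integrable_mult_right in_L2_box) (auto simp: space_restrict_space intro!: mult_right_mono)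
  then show ?thesis
    by (simp add: grad_sq_def)
qed

end

section \<open>The energy inequality tested with the comparison field\<close>

locale ensemble_wall = ensemble L U \<nu> \<tau> \<mu>\<^sub>0 \<mu>\<^sub>\<beta> \<beta> J \<mu> u0 u Du \<nu>\<^sub>t + wall_layer L U \<beta>
  for L U \<nu> \<tau> \<mu>\<^sub>0 \<mu>\<^sub>\<beta> \<beta> J \<mu> u0 u Du \<nu>\<^sub>t
begin

text \<open>The term with the time derivative is left out: as \<phi> is steady, it integrates to a
  difference of end values, treated together with the kinetic energy.\<close>

definition rhs :: "nat \<Rightarrow> real \<Rightarrow> real" where
  "rhs j t = (\<integral>x. (\<nu> + \<nu>\<^sub>t t x) * (Du j t x \<bullet> D\<phi> x) \<partial>box_measure L) + (\<integral>x. (Du j t x *v u j t x) \<bullet> \<phi> x \<partial>box_measure L)"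

text \<open>One factor \<open>slope\<close> is replaced by its maximum, the other is kept as the
  weight of the Poincare inequality. Away from the layer \<open>slope\<close> vanishes, so only the
  wall value of \<mu> enters.\<close>

lemma nu_t_slope_square_le:
  assumes x: "x \<in> Omega L"
  shows "\<nu>\<^sub>t t x * (slope x)\<^sup>2
      \<le> \<mu>\<^sub>\<beta> * \<tau> * (2 * U / (\<beta> * L)) * ens_avg J (\<lambda>j. slope x * (norm (u j t x - U *\<^sub>R axis 1 1))\<^sup>2)"
proof (cases "x \<in> near_wall L \<beta>")
  case True
  let ?A = "ens_avg J (\<lambda>j. (norm (u j t x - U *\<^sub>R axis 1 1))\<^sup>2)"
  have "fluct_sq J u t x * (slope x * slope x) \<le> ?A * (slope x * (2 * U / (\<beta> * L)))"
    using slope_le[OF x] by (intro mult_mono fluct_sq_le J mult_left_mono) (auto simp: ens_avg_def sum_nonneg)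
  then have "\<mu>\<^sub>\<beta> * \<tau> * (fluct_sq J u t x * (slope x * slope x)) \<le> \<mu>\<^sub>\<beta> * \<tau> * (?A * (slope x * (2 * U / (\<beta> * L))))"
    using mu_pos pos by (intro mult_left_mono) auto
  then show ?thesis
    using True by (simp add: nu_turb eddy_viscosity_def mu_wall ens_avg_mult power2_eq_square mult_ac)
next
  case False
  then have "\<not> ramp (x $ 3) > 0"
    using ramp_pos_imp[of "x $ 3"] x by (auto simp: near_wall_def mem_Omega less_imp_le)
  then have "ramp (x $ 3) = 0"
    using ramp_nonneg[of "x $ 3"] by linarith
  then show ?thesis
    by (simp add: slope_def ens_avg_def)
qed

text \<open>Young's inequality with weight one half on the viscous product: half of the dissipation,
  plus half of the total viscosity times \<open>slope\<^sup>2\<close>. For the molecular part that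
  square is integrated exactly; for the eddy part the factor \<open>1 / (\<beta> * L)\<close>
  cancels against the \<open>\<beta> * L\<close> of the Poincare inequality.\<close>

lemma rhs_le:
  assumes reg: "regular t" and j: "j \<in> {1..J}"
  shows "rhs j t \<le> 1 / 2 * dissipation j t + 2 / 3 * \<nu> * U\<^sup>2 * L / \<beta>
      + \<mu>\<^sub>\<beta> * \<tau> * U\<^sup>2 * ens_avg J (\<lambda>i. grad_sq i t) + U * \<beta> * L / 2 * grad_sq j t"
proof -
  have H1: "in_L2 (Omega L) (Du i t)" "div_free_H1 (Omega L) (Du i t)" "shear_bc L U (u i t) (Du i t)"
    "integrable (box_measure L) (\<lambda>x. (\<nu> + \<nu>\<^sub>t t x) * (norm (Du i t x))\<^sup>2)" if "i \<in> {1..J}" for i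
    using reg that by (auto simp: regular_def in_H1_def)
  define c where "c = \<mu>\<^sub>\<beta> * \<tau> * (2 * U / (\<beta> * L))"
  have c: "c \<ge> 0"
    using pos mu_pos \<beta> by (simp add: c_def)
  let ?d = "\<lambda>i x. slope x * (norm (u i t x - U *\<^sub>R axis 1 1))\<^sup>2"
  let ?B = "\<lambda>x. 1 / 2 * ((\<nu> + \<nu>\<^sub>t t x) * (norm (Du j t x))\<^sup>2) + (\<nu> / 2 * (slope x)\<^sup>2
      + c / 2 * ens_avg J (\<lambda>i. ?d i x))"
  note pw = poincare_wall_vector[OF H1(1) H1(3)]
  have intd: "integrable (box_measure L) (\<lambda>x. ens_avg J (\<lambda>i. ?d i x))"
    by (intro integrable_ens_avg pw)
  have intB: "integrable (box_measure L) ?B"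
    by (intro Bochner_Integration.integrable_add integrable_mult_right H1(4) j integral_slope_square intd)
  have nn: "0 \<le> ens_avg J (\<lambda>i. ?d i x)" for x
    by (auto simp: ens_avg_def intro!: divide_nonneg_nonneg sum_nonneg)
  have "(\<integral>x. (\<nu> + \<nu>\<^sub>t t x) * (Du j t x \<bullet> D\<phi> x) \<partial>box_measure L) \<le> (\<integral>x. ?B x \<partial>box_measure L)"
  proof (rule integral_mono_AE')
    show "AE x in box_measure L. (\<nu> + \<nu>\<^sub>t t x) * (Du j t x \<bullet> D\<phi> x) \<le> ?B x"
    proof (rule AE_I2)
      fix x assume "x \<in> space (box_measure L)"
      then have x: "x \<in> Omega L"
        by (simp add: space_restrict_space)
      have "Du j t x \<bullet> D\<phi> x \<le> norm (Du j t x) * slope x"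
        using norm_cauchy_schwarz[of "Du j t x" "D\<phi> x"] by (simp add: norm_D\<phi>)
      also have "\<dots> \<le> ((norm (Du j t x))\<^sup>2 + (slope x)\<^sup>2) / 2"
        using abs_mult_le_half_squares[of "norm (Du j t x)" "slope x"] by linarith
      finally have "(\<nu> + \<nu>\<^sub>t t x) * (Du j t x \<bullet> D\<phi> x) \<le> (\<nu> + \<nu>\<^sub>t t x) * (((norm (Du j t x))\<^sup>2 + (slope x)\<^sup>2) / 2)"
        using pos nu_t_nonneg[OF x, of t] by (intro mult_left_mono) auto
      also have "\<dots> = 1 / 2 * ((\<nu> + \<nu>\<^sub>t t x) * (norm (Du j t x))\<^sup>2) + (\<nu> / 2 * (slope x)\<^sup>2
          + 1 / 2 * (\<nu>\<^sub>t t x * (slope x)\<^sup>2))"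
        by (simp add: field_simps)
      also have "\<dots> \<le> ?B x"
        using nu_t_slope_square_le[OF x, of t] unfolding c_def[symmetric] by simp
      finally show "(\<nu> + \<nu>\<^sub>t t x) * (Du j t x \<bullet> D\<phi> x) \<le> ?B x" .
    qed
    show "AE x in box_measure L. 0 \<le> ?B x"
      using pos c nu_t_nonneg nn
      by (intro AE_I2 add_nonneg_nonneg mult_nonneg_nonneg divide_nonneg_nonneg) (auto simp: space_restrict_space)
  qed (rule intB)
  also have "\<dots> = 1 / 2 * dissipation j t + (\<nu> / 2 * (4 / 3 * U\<^sup>2 * L / \<beta>)
      + c / 2 * ens_avg J (\<lambda>i. \<integral>x. ?d i x \<partial>box_measure L))"
    using H1(4)[OF j] integral_slope_square intd integral_ens_avg[of J "box_measure L" ?d] pw(1)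
    by (simp add: dissipation_def)
  also have "\<dots> \<le> 1 / 2 * dissipation j t + (\<nu> / 2 * (4 / 3 * U\<^sup>2 * L / \<beta>)
      + c / 2 * ens_avg J (\<lambda>i. U * \<beta> * L * grad_sq i t))"
    unfolding grad_sq_def using c
    by (intro add_left_mono mult_left_mono ens_avg_mono pw) auto
  also have "\<dots> = 1 / 2 * dissipation j t + 2 / 3 * \<nu> * U\<^sup>2 * L / \<beta> + \<mu>\<^sub>\<beta> * \<tau> * U\<^sup>2 * ens_avg J (\<lambda>i. grad_sq i t)"
    by (simp add: ens_avg_mult power2_eq_square c_def)
  finally show ?thesis
    using convective_bound[OF H1(1-3)[OF j]] by (simp add: rhs_def grad_sq_def)
qed

text \<open>The energy inequality is granted only for fields with these two properties. Since \<phi>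
  and \<open>D\<phi>\<close> are bounded on the box, Young's inequality reduces them to the
  integrability of dissipation, eddy viscosity, squared gradient and squared velocity.\<close>

lemma integrable_rhs:
  assumes j: "j \<in> {1..J}" and T: "T > 0"
  shows "integrable (space_time T L) (\<lambda>p. (\<nu> + \<nu>\<^sub>t (fst p) (snd p)) * (Du j (fst p) (snd p) \<bullet> D\<phi> (snd p)))" (is "integrable _ ?f")
    and "integrable (space_time T L) (\<lambda>p. (Du j (fst p) (snd p) *v u j (fst p) (snd p)) \<bullet> \<phi> (snd p))" (is "integrable _ ?g")
proof -
  note [measurable] = measurable_u[OF j] measurable_nu_t
  have snd_meas [measurable]: "snd \<in> borel_measurable (space_time T L)"
    by (intro measurable_restrict_space1) (simp add: borel_prod[symmetric])
  have [measurable]: "D\<phi> \<in> borel_measurable borel" "\<phi>\<^sub>1 \<in> borel_measurable borel"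
    by (intro borel_measurable_continuous_onI continuous_on_D\<phi> continuous_on_\<phi>\<^sub>1)+
  have row [measurable]: "(\<lambda>p. Du j (fst p) (snd p) $ 1) \<in> borel_measurable (space_time T L)"
    by (rule measurable_compose[OF measurable_u(2)[OF j]])
       (auto intro!: borel_measurable_continuous_onI continuous_intros)
  have const: "integrable (space_time T L) (\<lambda>_. c :: real)" for c
    by (rule integrable_continuous_bounded_set[OF continuous_on_const])
       (auto intro!: bounded_Times bounded_Omega)
  let ?m = "2 * U / (\<beta> * L)"
  note ints = integrable_total_viscosity[OF j T] integrable_space_time[OF j T] integrable_nu_t[OF T]
  show "integrable (space_time T L) ?f"
  proof (rule Bochner_Integration.integrable_bound)
    show "integrable (space_time T L) (\<lambda>p. ((\<nu> + \<nu>\<^sub>t (fst p) (snd p)) * (norm (Du j (fst p) (snd p)))\<^sup>2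
        + (\<nu> + \<nu>\<^sub>t (fst p) (snd p)) * ?m\<^sup>2) / 2)"
      using ints const[of \<nu>] by simp
    show "AE p in space_time T L. norm (?f p) \<le> norm (((\<nu> + \<nu>\<^sub>t (fst p) (snd p)) * (norm (Du j (fst p) (snd p)))\<^sup>2
        + (\<nu> + \<nu>\<^sub>t (fst p) (snd p)) * ?m\<^sup>2) / 2)"
    proof (rule AE_I2)
      fix p assume "p \<in> space (space_time T L)"
      then have x: "snd p \<in> Omega L"
        by (auto simp: space_restrict_space)
      have "\<bar>Du j (fst p) (snd p) \<bullet> D\<phi> (snd p)\<bar> \<le> norm (Du j (fst p) (snd p)) * ?m"
        by (rule order_trans[OF Cauchy_Schwarz_ineq2]) (intro mult_left_mono, auto simp: norm_D\<phi> slope_le[OF x] simp del: times_divide_eq_right)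
      also have "\<dots> \<le> ((norm (Du j (fst p) (snd p)))\<^sup>2 + ?m\<^sup>2) / 2"
        using abs_mult_le_half_squares[of "norm (Du j (fst p) (snd p))" ?m] by linarith
      finally have "(\<nu> + \<nu>\<^sub>t (fst p) (snd p)) * \<bar>Du j (fst p) (snd p) \<bullet> D\<phi> (snd p)\<bar>
          \<le> (\<nu> + \<nu>\<^sub>t (fst p) (snd p)) * (((norm (Du j (fst p) (snd p)))\<^sup>2 + ?m\<^sup>2) / 2)"
        using pos nu_t_nonneg[OF x, of "fst p"] by (intro mult_left_mono) auto
      then have "\<bar>?f p\<bar> \<le> ((\<nu> + \<nu>\<^sub>t (fst p) (snd p)) * (norm (Du j (fst p) (snd p)))\<^sup>2
        + (\<nu> + \<nu>\<^sub>t (fst p) (snd p)) * ?m\<^sup>2) / 2"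
        using pos nu_t_nonneg[OF x, of "fst p"] by (simp add: abs_mult distrib_left)
      then show "norm (?f p) \<le> norm (((\<nu> + \<nu>\<^sub>t (fst p) (snd p)) * (norm (Du j (fst p) (snd p)))\<^sup>2
        + (\<nu> + \<nu>\<^sub>t (fst p) (snd p)) * ?m\<^sup>2) / 2)"
        unfolding real_norm_def by (rule order_trans) (rule abs_ge_self)
    qed
  qed measurable
  have g_eq: "?g p = \<phi>\<^sub>1 (snd p) * (Du j (fst p) (snd p) $ 1 \<bullet> u j (fst p) (snd p))" for p
    by (simp add: \<phi>_def inner_axis matrix_vector_mul_component)
  show "integrable (space_time T L) ?g"
  proof (rule Bochner_Integration.integrable_bound)
    show "integrable (space_time T L) (\<lambda>p. U * (((norm (Du j (fst p) (snd p)))\<^sup>2 + (norm (u j (fst p) (snd p)))\<^sup>2) / 2))"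
      using ints by simp
    show "AE p in space_time T L. norm (?g p)
        \<le> norm (U * (((norm (Du j (fst p) (snd p)))\<^sup>2 + (norm (u j (fst p) (snd p)))\<^sup>2) / 2))"
    proof (rule AE_I2)
      fix p assume "p \<in> space (space_time T L)"
      then have x: "snd p \<in> Omega L"
        by (auto simp: space_restrict_space)
      have "\<bar>Du j (fst p) (snd p) $ 1 \<bullet> u j (fst p) (snd p)\<bar> \<le> norm (Du j (fst p) (snd p)) * norm (u j (fst p) (snd p))"
        by (rule order_trans[OF Cauchy_Schwarz_ineq2])
          (intro mult_right_mono Finite_Cartesian_Product.norm_nth_le norm_ge_zero)
      also have "\<dots> \<le> ((norm (Du j (fst p) (snd p)))\<^sup>2 + (norm (u j (fst p) (snd p)))\<^sup>2) / 2"
        using abs_mult_le_half_squares[of "norm (Du j (fst p) (snd p))" "norm (u j (fst p) (snd p))"] by linarith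
      finally have "\<bar>\<phi>\<^sub>1 (snd p)\<bar> * \<bar>Du j (fst p) (snd p) $ 1 \<bullet> u j (fst p) (snd p)\<bar>
         \<le> U * (((norm (Du j (fst p) (snd p)))\<^sup>2 + (norm (u j (fst p) (snd p)))\<^sup>2) / 2)"
        using \<phi>\<^sub>1_le[OF x] by (intro mult_mono) auto
      then show "norm (?g p) \<le> norm (U * (((norm (Du j (fst p) (snd p)))\<^sup>2 + (norm (u j (fst p) (snd p)))\<^sup>2) / 2))"
        unfolding real_norm_def g_eq abs_mult[of "\<phi>\<^sub>1 (snd p)"] by (rule order_trans) (rule abs_ge_self)
    qed
    show "?g \<in> borel_measurable (space_time T L)"
      unfolding g_eq by measurable
  qed
qed

definition initial_bound :: "nat \<Rightarrow> real" where
  "initial_bound j = 1/2 * (\<integral>x. (norm (u j 0 x - \<phi> x))\<^sup>2 \<partial>box_measure L)"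

text \<open>Completing the square combines kinetic energy and end values into \<open>1/2 *
  \<parallel>u(T) - \<phi>\<parallel>\<^sup>2 - 1/2 * \<parallel>u(0) -
  \<phi>\<parallel>\<^sup>2\<close>. The first term is nonnegative and is dropped, so no bound on
  the velocity uniform in time is required; the second does not depend on \<open>T\<close> and
  disappears in the long-time average.\<close>

lemma energy_rhs:
  assumes j: "j \<in> {1..J}" and T: "T > 0"
  shows "integrable (time_measure T) (rhs j)"
    and "(\<integral>t. dissipation j t \<partial>time_measure T) \<le> initial_bound j + (\<integral>t. rhs j t \<partial>time_measure T)"
proof -
  note W = fubini_space_time(2)[OF integrable_rhs(1)[OF j T], simplified]
  note V = fubini_space_time(2)[OF integrable_rhs(2)[OF j T], simplified]
  show "integrable (time_measure T) (rhs j)"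
    unfolding rhs_def[abs_def] using W V by (rule Bochner_Integration.integrable_add)
  have "in_L2 (Omega L) (u j t)" if "t \<ge> 0" for t
    using solution[OF j] that by (simp add: weak_solution_def)
  note u_L2 = in_L2_box[OF this]
  have \<phi>_L2: "\<phi> \<in> borel_measurable (box_measure L)" "integrable (box_measure L) (\<lambda>x. (norm (\<phi> x))\<^sup>2)"
    using in_H1_\<phi> in_L2_box by (auto simp: in_H1_def)
  have ip: "integrable (box_measure L) (\<lambda>x. u j t x \<bullet> \<phi> x)" if "t \<ge> 0" for t
  proof (rule Bochner_Integration.integrable_bound)
    show "integrable (box_measure L) (\<lambda>x. ((norm (u j t x))\<^sup>2 + (norm (\<phi> x))\<^sup>2) / 2)"
      using u_L2[OF that] \<phi>_L2 by simp
    show "(\<lambda>x. u j t x \<bullet> \<phi> x) \<in> borel_measurable (box_measure L)"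
      using u_L2(1)[OF that] \<phi>_L2(1) by measurable
    have "\<bar>u j t x \<bullet> \<phi> x\<bar> \<le> ((norm (u j t x))\<^sup>2 + (norm (\<phi> x))\<^sup>2) / 2" for x
      using order_trans[OF Cauchy_Schwarz_ineq2[of "u j t x" "\<phi> x"] order_trans[OF abs_ge_self abs_mult_le_half_squares]] .
    then show "AE x in box_measure L. norm (u j t x \<bullet> \<phi> x) \<le> norm (((norm (u j t x))\<^sup>2 + (norm (\<phi> x))\<^sup>2) / 2)"
      by simp
  qed
  have expand: "(norm (u j t x - \<phi> x))\<^sup>2 = (norm (u j t x))\<^sup>2 - 2 * (u j t x \<bullet> \<phi> x) + (norm (\<phi> x))\<^sup>2" for t x
    by (simp add: power2_norm_eq_inner inner_diff_left inner_diff_right inner_commute)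
  have kin: "(\<integral>x. (norm (u j t x - \<phi> x))\<^sup>2 \<partial>box_measure L) = (\<integral>x. (norm (u j t x))\<^sup>2 \<partial>box_measure L)
      - 2 * (\<integral>x. u j t x \<bullet> \<phi> x \<partial>box_measure L) + (\<integral>x. (norm (\<phi> x))\<^sup>2 \<partial>box_measure L)" if "t \<ge> 0" for t
    unfolding expand using u_L2[OF that] \<phi>_L2 ip[OF that] by simp
  have "in_H1 (Omega L) \<phi> D\<phi> \<and> div_free_H1 (Omega L) D\<phi> \<and> shear_bc L U \<phi> D\<phi> \<and>
        set_integrable lborel ({0..T} \<times> Omega L) (\<lambda>(t, x). (\<nu> + \<nu>\<^sub>t t x) * (Du j t x \<bullet> D\<phi> x)) \<and>
        set_integrable lborel ({0..T} \<times> Omega L) (\<lambda>(t, x). (Du j t x *v u j t x) \<bullet> \<phi> x)"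
    using in_H1_\<phi> div_free_\<phi> shear_bc_\<phi> integrable_rhs[OF j T]
    by (simp add: set_integrable_restrict_lborel case_prod_unfold)
  with energy[OF j, unfolded energy_inequality_def, rule_format, OF T]
  have "1/2 * (LINT x:Omega L|lborel. (norm (u j T x))\<^sup>2) - 1/2 * (LINT x:Omega L|lborel. (norm (u j 0 x))\<^sup>2)
        + (LINT t:{0..T}|lborel. (LINT x:Omega L|lborel. (\<nu> + \<nu>\<^sub>t t x) * (norm (Du j t x))\<^sup>2))
        \<le> (LINT x:Omega L|lborel. (u j T x - u j 0 x) \<bullet> \<phi> x)
        + (LINT t:{0..T}|lborel. (LINT x:Omega L|lborel. (\<nu> + \<nu>\<^sub>t t x) * (Du j t x \<bullet> D\<phi> x)))
        + (LINT t:{0..T}|lborel. (LINT x:Omega L|lborel. (Du j t x *v u j t x) \<bullet> \<phi> x))"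
    by blast
  then have "1/2 * (\<integral>x. (norm (u j T x))\<^sup>2 \<partial>box_measure L) - 1/2 * (\<integral>x. (norm (u j 0 x))\<^sup>2 \<partial>box_measure L)
      + (\<integral>t. dissipation j t \<partial>time_measure T)
      \<le> (\<integral>x. (u j T x - u j 0 x) \<bullet> \<phi> x \<partial>box_measure L) + (\<integral>t. rhs j t \<partial>time_measure T)"
    unfolding rhs_def using W V by (simp add: integral_restrict_lborel dissipation_def)
  moreover have "(\<integral>x. (u j T x - u j 0 x) \<bullet> \<phi> x \<partial>box_measure L)
      = (\<integral>x. u j T x \<bullet> \<phi> x \<partial>box_measure L) - (\<integral>x. u j 0 x \<bullet> \<phi> x \<partial>box_measure L)"
    using ip T by (simp add: inner_diff_left)
  moreover have "0 \<le> (\<integral>x. (norm (u j T x - \<phi> x))\<^sup>2 \<partial>box_measure L)"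
    by simp
  ultimately show "(\<integral>t. dissipation j t \<partial>time_measure T) \<le> initial_bound j + (\<integral>t. rhs j t \<partial>time_measure T)"
    using kin[OF less_imp_le[OF T]] kin[OF order_refl] unfolding initial_bound_def by linarith
qed

text \<open>The bound for one realization contains its own gradient and the ensemble mean of all
  gradients; averaging over \<open>j\<close> merges the two into one coefficient.\<close>

lemma energy_estimate:
  assumes T: "T > 0"
  shows "1 / 2 * (\<integral>t. ens_avg J (\<lambda>j. dissipation j t) \<partial>time_measure T)
     \<le> ens_avg J initial_bound + T * (2 / 3 * \<nu> * U\<^sup>2 * L / \<beta>)
       + (\<mu>\<^sub>\<beta> * \<tau> * U\<^sup>2 + U * \<beta> * L / 2) * (\<integral>t. ens_avg J (\<lambda>j. grad_sq j t) \<partial>time_measure T)"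
proof -
  let ?Y = "\<lambda>t. ens_avg J (\<lambda>j. dissipation j t)" and ?X = "\<lambda>t. ens_avg J (\<lambda>j. grad_sq j t)"
  let ?b = "\<mu>\<^sub>\<beta> * \<tau> * U\<^sup>2 + U * \<beta> * L / 2" and ?a = "2 / 3 * \<nu> * U\<^sup>2 * L / \<beta>"
  have Y: "integrable (time_measure T) ?Y" and X: "integrable (time_measure T) ?X"
    and R: "integrable (time_measure T) (\<lambda>t. ens_avg J (\<lambda>j. rhs j t))"
    using integrable_dissipation[OF _ T] integrable_grad_sq[OF _ T] energy_rhs(1)[OF _ T]
    by (auto intro!: integrable_ens_avg)
  have const: "integrable (time_measure T) (\<lambda>t. ?a)"
    by (rule integrable_continuous_bounded_set[OF continuous_on_const]) auto
  have "(\<integral>t. ?Y t \<partial>time_measure T) = ens_avg J (\<lambda>j. \<integral>t. dissipation j t \<partial>time_measure T)"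
    by (rule integral_ens_avg[OF integrable_dissipation[OF _ T]])
  also have "\<dots> \<le> ens_avg J (\<lambda>j. initial_bound j + (\<integral>t. rhs j t \<partial>time_measure T))"
    by (intro ens_avg_mono energy_rhs(2) T)
  also have "\<dots> = ens_avg J initial_bound + (\<integral>t. ens_avg J (\<lambda>j. rhs j t) \<partial>time_measure T)"
    unfolding ens_avg_add using integral_ens_avg[OF energy_rhs(1)[OF _ T]] by simp
  also have "(\<integral>t. ens_avg J (\<lambda>j. rhs j t) \<partial>time_measure T) \<le> (\<integral>t. 1 / 2 * ?Y t + ?a + ?b * ?X t \<partial>time_measure T)"
  proof (rule integral_mono_AE[OF R])
    show "integrable (time_measure T) (\<lambda>t. 1 / 2 * ?Y t + ?a + ?b * ?X t)"
      using X Y const by (intro Bochner_Integration.integrable_add integrable_mult_right)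
    show "AE t in time_measure T. ens_avg J (\<lambda>j. rhs j t) \<le> 1 / 2 * ?Y t + ?a + ?b * ?X t"
      using AE_regular[OF T]
    proof eventually_elim
      case (elim t)
      have "ens_avg J (\<lambda>j. rhs j t) \<le> ens_avg J (\<lambda>j. 1 / 2 * dissipation j t + ?a
          + \<mu>\<^sub>\<beta> * \<tau> * U\<^sup>2 * ?X t + U * \<beta> * L / 2 * grad_sq j t)"
        by (intro ens_avg_mono rhs_le elim)
      also have "\<dots> = 1 / 2 * ?Y t + ?a + ?b * ?X t"
        unfolding ens_avg_add ens_avg_mult ens_avg_const[OF J] by (simp add: distrib_right)
      finally show ?case .
    qed
  qed
  also have "\<dots> = 1 / 2 * (\<integral>t. ?Y t \<partial>time_measure T) + T * ?a + ?b * (\<integral>t. ?X t \<partial>time_measure T)"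
  proof -
    have "(\<integral>t. 1 / 2 * ?Y t + ?a + ?b * ?X t \<partial>time_measure T)
        = (\<integral>t. 1 / 2 * ?Y t + ?a \<partial>time_measure T) + (\<integral>t. ?b * ?X t \<partial>time_measure T)"
      using X Y const by (intro Bochner_Integration.integral_add Bochner_Integration.integrable_add integrable_mult_right)
    also have "(\<integral>t. 1 / 2 * ?Y t + ?a \<partial>time_measure T) = (\<integral>t. 1 / 2 * ?Y t \<partial>time_measure T) + (\<integral>t. ?a \<partial>time_measure T)"
      using Y const by (intro Bochner_Integration.integral_add integrable_mult_right)
    also have "(\<integral>t. ?a \<partial>time_measure T) = T * ?a"
      using measure_space_restrict_lborel[of "{0..T}"] T by simp
    finally show ?thesis
      by simp
  qed
  finally show ?thesis
    by simp
qed

end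

section \<open>Long-time averages\<close>

text \<open>Upper limits are only subadditive, which suffices because \<open>b\<close> is
  nonnegative and \<open>h\<close> converges. It serves in both directions: dissipation against
  gradient, and gradient against dissipation.\<close>

lemma Limsup_le_affine:
  fixes E G h :: "real \<Rightarrow> real"
  assumes e: "Limsup at_top (\<lambda>T. ereal (E T)) = ereal e"
    and g: "Limsup at_top (\<lambda>T. ereal (G T)) = ereal g"
    and h: "(h \<longlongrightarrow> a) at_top" and b: "b \<ge> 0"
    and le: "\<And>T. T > 0 \<Longrightarrow> E T \<le> h T + b * G T"
  shows "e \<le> a + b * g"
proof (rule field_le_epsilon)
  fix r :: real assume r: "r > 0"
  \<comment> \<open>The errors in \<open>h\<close> and in \<open>b * G\<close> add up to
    \<open>d + b * d = r\<close>.\<close>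
  define d where "d = r / (1 + b)"
  have d: "d > 0" "(1 + b) * d = r"
    using r b by (auto simp: d_def)
  have "\<forall>\<^sub>F T in at_top. ereal (G T) < ereal (g + d)"
    using d by (intro Limsup_lessD) (simp add: g)
  moreover have "\<forall>\<^sub>F T in at_top. h T < a + d"
    using d by (intro order_tendstoD(2)[OF h]) simp
  moreover have "\<forall>\<^sub>F T in at_top. T > (0::real)"
    by (rule eventually_gt_at_top)
  ultimately have "\<forall>\<^sub>F T in at_top. ereal (E T) \<le> ereal ((a + d) + b * (g + d))"
  proof eventually_elim
    case (elim T)
    then have "E T \<le> h T + b * G T"
      by (intro le)
    also have "\<dots> \<le> (a + d) + b * (g + d)"
      using elim b by (intro add_mono mult_left_mono) auto
    finally show ?case
      by simp
  qed
  then have "Limsup at_top (\<lambda>T. ereal (E T)) \<le> ereal ((a + d) + b * (g + d))"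
    by (rule Limsup_bounded)
  then show "e \<le> a + b * g + r"
    using d by (simp add: e distrib_left distrib_right)
qed

text \<open>Finiteness from above is a hypothesis of the theorem and the lower bound excludes minus
  infinity; hence \<open>real_of_ereal\<close> in the effective viscosity returns the actual
  averages.\<close>

lemma Limsup_real:
  fixes E :: "real \<Rightarrow> real"
  assumes "Limsup at_top (\<lambda>T. ereal (E T)) < \<infinity>" and le: "\<And>T. T > 0 \<Longrightarrow> c \<le> E T"
  obtains e where "Limsup at_top (\<lambda>T. ereal (E T)) = ereal e" "c \<le> e"
proof -
  have "\<forall>\<^sub>F T in at_top. ereal c \<le> ereal (E T)"
    using eventually_gt_at_top[of "0::real"] by eventually_elim (simp add: le)
  then have c: "ereal c \<le> Limsup at_top (\<lambda>T. ereal (E T))"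
    by (intro le_Limsup) auto
  then obtain e where "Limsup at_top (\<lambda>T. ereal (E T)) = ereal e"
    using assms(1) by (cases "Limsup at_top (\<lambda>T. ereal (E T))") auto
  with c that show ?thesis
    by simp
qed

section \<open>Dissipation and squared gradient averaged over finite times\<close>

context ensemble
begin

definition mean_E :: "real \<Rightarrow> real" where
  "mean_E T = 1 / (T * L ^ 3) * (\<integral>t. ens_avg J (\<lambda>j. dissipation j t) \<partial>time_measure T)"

definition mean_G :: "real \<Rightarrow> real" where
  "mean_G T = 1 / (T * L ^ 3) * (\<integral>t. ens_avg J (\<lambda>j. grad_sq j t) \<partial>time_measure T)"

lemma space_avg_eq: "space_avg L f = 1 / L ^ 3 * (\<integral>x. f x \<partial>box_measure L)"
  using pos by (simp add: space_avg_def measure_Omega integral_restrict_lborel)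

lemma mean_dissipation_eq: "mean_dissipation L J \<nu> \<nu>\<^sub>t Du = Limsup at_top (\<lambda>T. ereal (mean_E T))"
  by (simp add: mean_dissipation_def time_avg_def space_avg_eq ens_avg_divide integral_restrict_lborel
      mean_E_def dissipation_def mult.commute[of _ "L ^ 3"])

lemma mean_grad_sq_eq: "mean_grad_sq L J Du = Limsup at_top (\<lambda>T. ereal (mean_G T))"
  by (simp add: mean_grad_sq_def time_avg_def space_avg_eq ens_avg_divide integral_restrict_lborel
      mean_G_def grad_sq_def mult.commute[of _ "L ^ 3"])

lemma mean_G_ge:
  assumes T: "T > 0"
  shows "U\<^sup>2 / L\<^sup>2 \<le> mean_G T"
proof -
  have X: "integrable (time_measure T) (\<lambda>t. ens_avg J (\<lambda>j. grad_sq j t))"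
    by (intro integrable_ens_avg integrable_grad_sq T)
  have const: "integrable (time_measure T) (\<lambda>t. U\<^sup>2 * L)"
    by (rule integrable_continuous_bounded_set[OF continuous_on_const]) auto
  have "T * (U\<^sup>2 * L) = (\<integral>t. U\<^sup>2 * L \<partial>time_measure T)"
    using measure_space_restrict_lborel[of "{0..T}"] T by simp
  also have "\<dots> \<le> (\<integral>t. ens_avg J (\<lambda>j. grad_sq j t) \<partial>time_measure T)"
  proof (rule integral_mono_AE[OF const X])
    show "AE t in time_measure T. U\<^sup>2 * L \<le> ens_avg J (\<lambda>j. grad_sq j t)"
      using AE_regular[OF T]
    proof eventually_elim
      case (elim t)
      have "ens_avg J (\<lambda>j. U\<^sup>2 * L) \<le> ens_avg J (\<lambda>j. grad_sq j t)"
        by (intro ens_avg_mono grad_sq_ge elim)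
      then show ?case
        by (simp only: ens_avg_const[OF J])
    qed
  qed
  finally have "1 / (T * L ^ 3) * (T * (U\<^sup>2 * L)) \<le> mean_G T"
    unfolding mean_G_def using T pos by (intro mult_left_mono) auto
  then show ?thesis
    using T pos by (simp add: power2_eq_square power3_eq_cube)
qed

text \<open>In the limit this says that the effective viscosity is at least the molecular one. It
  also trades \<open>\<nu> * g\<close> for the dissipation when the eddy term is absorbed.\<close>

lemma mean_E_ge:
  assumes T: "T > 0"
  shows "\<nu> * mean_G T \<le> mean_E T"
proof -
  have "\<nu> * (\<integral>t. ens_avg J (\<lambda>j. grad_sq j t) \<partial>time_measure T) = (\<integral>t. \<nu> * ens_avg J (\<lambda>j. grad_sq j t) \<partial>time_measure T)"
    by simp
  also have "\<dots> \<le> (\<integral>t. ens_avg J (\<lambda>j. dissipation j t) \<partial>time_measure T)"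
  proof (rule integral_mono_AE)
    show "AE t in time_measure T. \<nu> * ens_avg J (\<lambda>j. grad_sq j t) \<le> ens_avg J (\<lambda>j. dissipation j t)"
      using AE_regular[OF T]
      by eventually_elim (auto simp flip: ens_avg_mult intro!: ens_avg_mono dissipation_ge)
  qed (intro integrable_mult_right integrable_ens_avg integrable_grad_sq integrable_dissipation T; assumption)+
  finally have "1 / (T * L ^ 3) * (\<nu> * (\<integral>t. ens_avg J (\<lambda>j. grad_sq j t) \<partial>time_measure T)) \<le> mean_E T"
    unfolding mean_E_def using T pos by (intro mult_left_mono) auto
  then show ?thesis
    by (simp add: mean_G_def mult_ac)
qed

end

text \<open>The energy estimate multiplied by \<open>2 / (T * L ^ 3)\<close>: 2 removes the half in
  front of the dissipation, the rest normalizes in time and space. The initial energy now carries a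
  factor \<open>inverse T\<close>.\<close>

lemma (in ensemble_wall) mean_E_le:
  assumes T: "T > 0"
  shows "mean_E T \<le> (2 * ens_avg J initial_bound / L ^ 3 * inverse T + 4 / 3 * \<nu> * U\<^sup>2 / (L\<^sup>2 * \<beta>))
     + (2 * (\<mu>\<^sub>\<beta> * \<tau> * U\<^sup>2) + U * \<beta> * L) * mean_G T"
proof -
  let ?y = "\<integral>t. ens_avg J (\<lambda>j. dissipation j t) \<partial>time_measure T"
  let ?x = "\<integral>t. ens_avg J (\<lambda>j. grad_sq j t) \<partial>time_measure T"
  let ?b = "\<mu>\<^sub>\<beta> * \<tau> * U\<^sup>2 + U * \<beta> * L / 2"
  have "mean_E T = 2 / (T * L ^ 3) * (1 / 2 * ?y)"
    by (simp add: mean_E_def)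
  also have "\<dots> \<le> 2 / (T * L ^ 3) * (ens_avg J initial_bound + T * (2 / 3 * \<nu> * U\<^sup>2 * L / \<beta>) + ?b * ?x)"
    using T L by (intro mult_left_mono energy_estimate) auto
  also have "\<dots> = 2 / (T * L ^ 3) * ens_avg J initial_bound + 2 / (T * L ^ 3) * (T * (2 / 3 * \<nu> * U\<^sup>2 * L / \<beta>))
      + 2 * ?b * (1 / (T * L ^ 3) * ?x)"
    by (simp add: distrib_left)
  also have "2 / (T * L ^ 3) * ens_avg J initial_bound = 2 * ens_avg J initial_bound / L ^ 3 * inverse T"
    by (simp add: field_simps)
  also have "2 / (T * L ^ 3) * (T * (2 / 3 * \<nu> * U\<^sup>2 * L / \<beta>)) = 4 / 3 * \<nu> * U\<^sup>2 / (L\<^sup>2 * \<beta>)"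
    using T by (simp add: power2_eq_square power3_eq_cube)
  also have "2 * ?b = 2 * (\<mu>\<^sub>\<beta> * \<tau> * U\<^sup>2) + U * \<beta> * L"
    by simp
  finally show ?thesis
    by (simp add: mean_G_def)
qed

section \<open>Positivity of the effective viscosity and absorption\<close>

theorem theorem3:
  fixes L U \<nu> \<tau> \<mu>\<^sub>0 \<mu>\<^sub>\<beta> \<beta> \<nu>\<^sub>e :: real
    and J :: nat
    and \<mu> :: "real^3 \<Rightarrow> real"
    and u0 :: "nat \<Rightarrow> real^3 \<Rightarrow> real^3"
    and u :: "nat \<Rightarrow> real \<Rightarrow> real^3 \<Rightarrow> real^3"
    and Du :: "nat \<Rightarrow> real \<Rightarrow> real^3 \<Rightarrow> real^3^3"
    and \<nu>\<^sub>t :: "real \<Rightarrow> real^3 \<Rightarrow> real"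
  assumes pos: "L > 0" "U > 0" "\<nu> > 0" "\<tau> > 0"
    and J: "J \<ge> 1"
    and tau: "\<tau> \<le> L / U"
    and nu_turb: "\<nu>\<^sub>t = eddy_viscosity J \<tau> \<mu> u"
    and solution: "\<And>j. j \<in> {1..J} \<Longrightarrow> weak_solution L U \<nu> \<nu>\<^sub>t (u0 j) (u j) (Du j)"
    and energy: "\<And>j. j \<in> {1..J} \<Longrightarrow> energy_inequality L U \<nu> \<nu>\<^sub>t (u j) (Du j)"
    and finite_averages: "mean_dissipation L J \<nu> \<nu>\<^sub>t Du < \<infinity>" "mean_grad_sq L J Du < \<infinity>"
    and nu_e: "\<nu>\<^sub>e = nu_eff L J \<nu> \<nu>\<^sub>t Du"
    and beta: "\<beta> = 1/8 * inverse (Reynolds U L \<nu>\<^sub>e)"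
    and beta_le: "\<beta> \<le> 1"
    and mu_pos: "\<mu>\<^sub>0 > 0" "\<mu>\<^sub>\<beta> > 0"
    and mu_interior: "\<And>x. x \<in> Omega L - near_wall L \<beta> \<Longrightarrow> \<mu> x = \<mu>\<^sub>0"
    and mu_wall: "\<And>x. x \<in> near_wall L \<beta> \<Longrightarrow> \<mu> x = \<mu>\<^sub>\<beta>"
    and mu_bound: "\<mu>\<^sub>\<beta> \<le> 0.27064 * inverse (Reynolds U L \<nu>)"
  shows "time_avg (eps_model L J \<nu> \<nu>\<^sub>t Du) \<le> ereal ((5 + 32 * (\<nu> / \<nu>\<^sub>e)) * (U ^ 3 / L))"

proof -
  interpret ensemble L U \<nu> \<tau> \<mu>\<^sub>0 \<mu>\<^sub>\<beta> \<beta> J \<mu> u0 u Du \<nu>\<^sub>t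
    by unfold_locales (fact assms)+
  obtain g where g: "Limsup at_top (\<lambda>T. ereal (mean_G T)) = ereal g" "U\<^sup>2 / L\<^sup>2 \<le> g"
    using Limsup_real[OF finite_averages(2)[unfolded mean_grad_sq_eq] mean_G_ge] by blast
  have g_pos: "g > 0"
    using pos by (intro less_le_trans[OF _ g(2)]) simp
  have "\<nu> * (U\<^sup>2 / L\<^sup>2) \<le> mean_E T" if "T > 0" for T
    using mean_G_ge[OF that] pos by (intro order_trans[OF _ mean_E_ge[OF that]] mult_left_mono) auto
  then obtain e where e: "Limsup at_top (\<lambda>T. ereal (mean_E T)) = ereal e"
    using Limsup_real[OF finite_averages(1)[unfolded mean_dissipation_eq]] by blast
  \<comment> \<open>The affine comparison with exchanged roles and zero inhomogeneity.\<close>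
  have "g \<le> 0 + 1 / \<nu> * e"
    using mean_E_ge pos by (intro Limsup_le_affine[OF g(1) e tendsto_const]) (auto simp: field_simps)
  then have ge: "\<nu> * g \<le> e"
    using pos by (simp add: field_simps)
  then have e_pos: "e > 0"
    using g_pos pos by (intro less_le_trans[OF _ ge]) simp
  have nu_e': "\<nu>\<^sub>e = e / g"
    by (simp add: nu_e nu_eff_def mean_dissipation_eq mean_grad_sq_eq e g(1))
  then have nu_e_pos: "\<nu>\<^sub>e > 0"
    using e_pos g_pos by simp
  have beta': "\<beta> = \<nu>\<^sub>e / (8 * U * L)"
    by (simp add: beta Reynolds_def)
  \<comment> \<open>Only now, with \<open>\<nu>\<^sub>e\<close> positive, is \<beta> known to be
    positive and the comparison field available.\<close>
  interpret ensemble_wall L U \<nu> \<tau> \<mu>\<^sub>0 \<mu>\<^sub>\<beta> \<beta> J \<mu> u0 u Du \<nu>\<^sub>t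
    using pos nu_e_pos beta_le by unfold_locales (auto simp: beta')
  define P where "P = \<nu> / \<nu>\<^sub>e * (U ^ 3 / L)"
  have P: "P > 0"
    using pos nu_e_pos by (simp add: P_def)
  have "((\<lambda>T. 2 * ens_avg J initial_bound / L ^ 3 * inverse T + 4 / 3 * \<nu> * U\<^sup>2 / (L\<^sup>2 * \<beta>))
      \<longlongrightarrow> 2 * ens_avg J initial_bound / L ^ 3 * 0 + 4 / 3 * \<nu> * U\<^sup>2 / (L\<^sup>2 * \<beta>)) at_top"
    by (intro tendsto_intros tendsto_inverse_0_at_top filterlim_ident)
  from Limsup_le_affine[OF e g(1) this _ mean_E_le]
  have "e \<le> 4 / 3 * \<nu> * U\<^sup>2 / (L\<^sup>2 * \<beta>) + (2 * (\<mu>\<^sub>\<beta> * \<tau> * U\<^sup>2) + U * \<beta> * L) * g"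
    using pos mu_pos nu_e_pos by (simp add: beta')
  \<comment> \<open>Substituting \<open>\<beta> = \<nu>\<^sub>e / (8 * U * L)\<close> makes the
    first term \<open>32/3 * P\<close>, and the convective term becomes
    \<open>\<nu>\<^sub>e * g / 8 = e / 8\<close>.\<close>
  also have "\<dots> = 32 / 3 * P + 2 * (\<mu>\<^sub>\<beta> * \<tau> * U\<^sup>2 * g) + e / 8"
    using pos e_pos g_pos by (simp add: beta' P_def nu_e' field_simps power2_eq_square power3_eq_cube)
  also have "\<mu>\<^sub>\<beta> * \<tau> * U\<^sup>2 * g \<le> 0.27064 * e"
  proof -
    \<comment> \<open>The bounds on \<open>\<mu>\<^sub>\<beta>\<close> and \<tau> together cancel
      all powers of \<open>U\<close> and \<open>L\<close> and leave
      \<open>0.27064 * \<nu>\<close>.\<close>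
    have "\<mu>\<^sub>\<beta> * \<tau> \<le> 0.27064 * inverse (Reynolds U L \<nu>) * (L / U)"
      using mu_pos pos by (intro mult_mono mu_bound tau) (auto simp: Reynolds_def)
    then have "\<mu>\<^sub>\<beta> * \<tau> * (U\<^sup>2 * g) \<le> 0.27064 * inverse (Reynolds U L \<nu>) * (L / U) * (U\<^sup>2 * g)"
      using g_pos by (intro mult_right_mono) auto
    also have "\<dots> = 0.27064 * (\<nu> * g)"
      using pos by (simp add: Reynolds_def power2_eq_square)
    finally show ?thesis
      using ge by (simp add: mult.assoc)
  qed
  \<comment> \<open>The absorbed terms leave \<open>1 - 1/8 - 2 * 0.27064 = 0.33372\<close>,
    slightly more than 1/3, in front of \<open>e\<close>; dividing by it multiplies 32/3 by less
    than 3.\<close>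
  finally have "e \<le> 32 * P"
    using P by simp
  \<comment> \<open>A nonnegative term is added to reach the form of the claim.\<close>
  also have "\<dots> \<le> 5 * (U ^ 3 / L) + 32 * P"
    using pos by simp
  also have "\<dots> = (5 + 32 * (\<nu> / \<nu>\<^sub>e)) * (U ^ 3 / L)"
    by (simp only: P_def distrib_right mult.assoc)
  finally have "e \<le> (5 + 32 * (\<nu> / \<nu>\<^sub>e)) * (U ^ 3 / L)" .
  moreover have "time_avg (eps_model L J \<nu> \<nu>\<^sub>t Du) = ereal e"
    unfolding e[symmetric] mean_dissipation_eq[symmetric]
    by (simp add: mean_dissipation_def eps_model_def[abs_def] distrib_right)
  ultimately show ?thesis
    by simp
qed

end
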